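(* Let $X\in\mathcal{VH}^1$ be a vector field with divergence. Then it has the form $$X(z,w)=\Bigl(z\sum_{p\ge1}\bigl(S_{p,q}(z,w),-S_{p-1,q+1}(z,w)\bigr)a_{p,q}+w\sum_{q\ge1}\bigl(S_{p+1,q-1}(z,w),-S_{p,q}(z,w)\bigr)b_{p,q}\Bigr)+\bigl(g_0(w),f_0(z)\bigr),$$ and its divergence is $$\mathrm{div}X(z,w)=\sum_{p,q\ge0}S_{p,q}(z,w)(a_{p,q}-b_{p,q}).$$
   Context: $\mathbb{H}$ is the algebra of quaternions; $z,w$ are two non-commuting quaternionic variables. Power series. For $\alpha=(\alpha_1,\dots,\alpha_d)\in\{0,1\}^d$ let $(z,w)^\alpha$ be the ordered product $(z^{\alpha_1}w^{1-\alpha_1})\cdots(z^{\alpha_d}w^{1-\alpha_d})$ and $|\alpha|=\sum_l\alpha_l$. $\mathcal{H}^1[z,w]$ denotes the set of functions given by absolutely convergent series $\sum_d f_d(z,w)$, where each $f_d$ is a finite sum $\sum_{\alpha\in\{0,1\}^d}(z,w)^{\alpha}a_{\alpha}$ with $a_\alpha\in\mathbb{H}$ (all coefficients on the right). Functions are assumed to be defined on all of $\mathbb{H}^2$, and formal uniqueness of the power series expansion is assumed: two such functions are the same if and only if the corresponding power series coincide. For $p,q\ge0$, $S_{p,q}(z,w)=\sum_{\alpha\in\{0,1\}^{p+q},\,|\alpha|=p}(z,w)^\alpha$ is the sum of all words with $p$ letters $z$ and $q$ letters $w$. Partial derivatives. For $h\in\mathbb{H}$, $\widehat{\partial}_z f(z,w)[h]=\lim_{t\to0}\frac1t\,(f(z+th,w)-f(z,w))$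 ($t$ real), and similarly $\widehat{\partial}_w f(z,w)[h]$ with respect to $w$. Vector fields. $\mathcal{VH}^1$ is the set of vector fields $X=(f,g)$ on $\mathbb{H}^2$ with $f,g\in\mathcal{H}^1[z,w]$. Put $\mathrm{Div}X(z,w)[h]=\widehat{\partial}_zf(z,w)[h]+\widehat{\partial}_wg(z,w)[h]$. $X$ has divergence if there is a function, denoted $\mathrm{div}X(z,w)$, such that $\mathrm{Div}X(z,w)[h]=h\,\mathrm{div}X(z,w)$. In the claim, $a_{p,q},b_{p,q}\in\mathbb{H}$; $g_0$ is a function of $w$ only and $f_0$ a function of $z$ only; the indices $p,q$ are non-negative integers, with the further restriction $p\ge1$ in the first sum and $q\ge1$ in the second. A quaternion or variable multiplying a pair multiplies both components, on the side on which it is written.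
   Formalization: Both sums run over all p,q≥0, with S read as 0 at a negative index: with p≥1 and q≥1 as printed, (z,0), of divergence 1, is not of the stated form. Formal uniqueness of the expansion, which fails on H², is not assumed; equality is equality of functions. *)

theory Defs
  imports "HOL-Analysis.Analysis"
begin

section \<open>The algebra of quaternions\<close>

datatype quat = Quat (qRe: real) (qI: real) (qJ: real) (qK: real)

lemma quat_eq_iff:
  "x = y \<longleftrightarrow> qRe x = qRe y \<and> qI x = qI y \<and> qJ x = qJ y \<and> qK x = qK y"
  by (cases x; cases y) auto

instantiation quat :: real_vector
begin

definition "(0::quat) = Quat 0 0 0 0"
definition "x + y = Quat (qRe x + qRe y) (qI x + qI y) (qJ x + qJ y) (qK x + qK y)"
definition "- x = Quat (- qRe x) (- qI x) (- qJ x) (- qK x)"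
definition "x - y = Quat (qRe x - qRe y) (qI x - qI y) (qJ x - qJ y) (qK x - qK y)"
definition "r *\<^sub>R x = Quat (r * qRe x) (r * qI x) (r * qJ x) (r * qK x)"

instance
  by standard
    (auto simp: zero_quat_def plus_quat_def uminus_quat_def minus_quat_def scaleR_quat_def
      algebra_simps quat_eq_iff)

end

lemma quat_linear_simps [simp]:
  "qRe 0 = 0" "qI 0 = 0" "qJ 0 = 0" "qK 0 = 0"
  "qRe (x + y) = qRe x + qRe y" "qI (x + y) = qI x + qI y"
  "qJ (x + y) = qJ x + qJ y" "qK (x + y) = qK x + qK y"
  "qRe (- x) = - qRe x" "qI (- x) = - qI x" "qJ (- x) = - qJ x" "qK (- x) = - qK x"
  "qRe (x - y) = qRe x - qRe y" "qI (x - y) = qI x - qI y"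
  "qJ (x - y) = qJ x - qJ y" "qK (x - y) = qK x - qK y"
  "qRe (r *\<^sub>R x) = r * qRe x" "qI (r *\<^sub>R x) = r * qI x"
  "qJ (r *\<^sub>R x) = r * qJ x" "qK (r *\<^sub>R x) = r * qK x"
  by (auto simp: zero_quat_def plus_quat_def uminus_quat_def minus_quat_def scaleR_quat_def)

instantiation quat :: real_algebra_1
begin

definition "(1::quat) = Quat 1 0 0 0"
definition "x * y = Quat
  (qRe x * qRe y - qI x * qI y - qJ x * qJ y - qK x * qK y)
  (qRe x * qI y + qI x * qRe y + qJ x * qK y - qK x * qJ y)
  (qRe x * qJ y - qI x * qK y + qJ x * qRe y + qK x * qI y)
  (qRe x * qK y + qI x * qJ y - qJ x * qI y + qK x * qRe y)"

instance
  by standard (auto simp: one_quat_def times_quat_def algebra_simps quat_eq_iff)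

end

lemma quat_mult_simps [simp]:
  "qRe 1 = 1" "qI 1 = 0" "qJ 1 = 0" "qK 1 = 0"
  "qRe (x * y) = qRe x * qRe y - qI x * qI y - qJ x * qJ y - qK x * qK y"
  "qI (x * y) = qRe x * qI y + qI x * qRe y + qJ x * qK y - qK x * qJ y"
  "qJ (x * y) = qRe x * qJ y - qI x * qK y + qJ x * qRe y + qK x * qI y"
  "qK (x * y) = qRe x * qK y + qI x * qJ y - qJ x * qI y + qK x * qRe y"
  by (auto simp: one_quat_def times_quat_def)

instantiation quat :: real_inner
begin

definition "inner x y = qRe x * qRe y + qI x * qI y + qJ x * qJ y + qK x * qK y"
definition "norm (x::quat) = sqrt (inner x x)"
definition "sgn (x::quat) = x /\<^sub>R norm x"
definition "dist (x::quat) y = norm (x - y)"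
definition "(uniformity :: (quat \<times> quat) filter) =
  (INF e\<in>{0 <..}. principal {(x, y). dist x y < e})"
definition "open (U :: quat set) \<longleftrightarrow>
  (\<forall>x\<in>U. eventually (\<lambda>(x', y). x' = x \<longrightarrow> y \<in> U) uniformity)"

instance
proof
  fix x y z :: quat and r :: real
  show "inner x y = inner y x" "inner (x + y) z = inner x z + inner y z"
    "inner (r *\<^sub>R x) y = r * inner x y" "0 \<le> inner x x"
    by (auto simp: inner_quat_def algebra_simps)
  show "inner x x = 0 \<longleftrightarrow> x = 0"
    by (simp add: inner_quat_def quat_eq_iff add_nonneg_eq_0_iff)
qed (auto simp: norm_quat_def sgn_quat_def dist_quat_def uniformity_quat_def open_quat_def)

end

lemma norm_quat_sq: "(norm x)\<^sup>2 = (qRe x)\<^sup>2 + (qI x)\<^sup>2 + (qJ x)\<^sup>2 + (qK x)\<^sup>2"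
  for x :: quat
  by (simp add: norm_quat_def inner_quat_def power2_eq_square)

instantiation quat :: real_normed_div_algebra
begin

definition "inverse x = Quat (qRe x / (norm x)\<^sup>2) (- qI x / (norm x)\<^sup>2)
  (- qJ x / (norm x)\<^sup>2) (- qK x / (norm x)\<^sup>2)"
definition "divide x y = x * inverse (y::quat)"

instance
proof
  fix x y :: quat
  show "x div y = x * inverse y"
    by (fact divide_quat_def)
  show "inverse (0::quat) = 0"
    by (simp add: inverse_quat_def quat_eq_iff)
  have "(norm (x * y))\<^sup>2 = (norm x * norm y)\<^sup>2"
    unfolding power_mult_distrib norm_quat_sq
    by (simp add: power2_eq_square algebra_simps)
  then show "norm (x * y) = norm x * norm y"
    by (simp add: power2_eq_iff_nonneg)
  assume "x \<noteq> 0"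
  then have nz: "(norm x)\<^sup>2 \<noteq> 0" by simp
  define c where "c = Quat (qRe x) (- qI x) (- qJ x) (- qK x)"
  have inv: "inverse x = (1 / (norm x)\<^sup>2) *\<^sub>R c"
    by (simp add: inverse_quat_def c_def quat_eq_iff)
  have "c * x = (norm x)\<^sup>2 *\<^sub>R 1" "x * c = (norm x)\<^sup>2 *\<^sub>R 1"
    unfolding norm_quat_sq by (simp_all add: c_def quat_eq_iff power2_eq_square)
  with nz show "inverse x * x = 1" "x * inverse x = 1"
    unfolding inv by simp_all
qed

end

instantiation quat :: euclidean_space
begin

definition "(Basis :: quat set) =
  {Quat 1 0 0 0, Quat 0 1 0 0, Quat 0 0 1 0, Quat 0 0 0 1}"

instance
proof
  fix x :: quat
  show "(\<forall>u\<in>Basis. inner x u = 0) \<longleftrightarrow> x = 0"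
    by (simp add: Basis_quat_def inner_quat_def quat_eq_iff [of x 0])
qed (auto simp: Basis_quat_def inner_quat_def)

end


section \<open>Power series in two non-commuting variables\<close>

text \<open>A multi-index in \<open>{0,1}^d\<close> is a Boolean list of length \<open>d\<close>, with
  \<^const>\<open>True\<close> for \<open>1\<close> (letter \<open>z\<close>) and \<^const>\<open>False\<close> for \<open>0\<close> (letter \<open>w\<close>).\<close>

definition word :: "quat \<Rightarrow> quat \<Rightarrow> bool list \<Rightarrow> quat" where
  "word z w \<alpha> = prod_list (map (\<lambda>l. if l then z else w) \<alpha>)"

definition weight :: "bool list \<Rightarrow> nat" where
  "weight \<alpha> = length (filter (\<lambda>l. l) \<alpha>)"

definition hom_part :: "(bool list \<Rightarrow> quat) \<Rightarrow> nat \<Rightarrow> quat \<Rightarrow> quat \<Rightarrow> quat" where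
  "hom_part a d z w = (\<Sum>\<alpha> | length \<alpha> = d. word z w \<alpha> * a \<alpha>)"

definition H1 :: "(quat \<Rightarrow> quat \<Rightarrow> quat) set" where
  "H1 = {f. \<exists>a. \<forall>z w. summable (\<lambda>d. norm (hom_part a d z w)) \<and>
                    f z w = (\<Sum>d. hom_part a d z w)}"

text \<open>The indices are integers so that \<open>S p q = 0\<close> (an empty sum) as soon as one of them is
  negative.\<close>

definition S :: "int \<Rightarrow> int \<Rightarrow> quat \<Rightarrow> quat \<Rightarrow> quat" where
  "S p q z w = (\<Sum>\<alpha> | int (length \<alpha>) = p + q \<and> int (weight \<alpha>) = p. word z w \<alpha>)"


section \<open>Vector fields and divergence\<close>

definition VH1 :: "(quat \<Rightarrow> quat \<Rightarrow> quat \<times> quat) set" where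
  "VH1 = {X. (\<lambda>z w. fst (X z w)) \<in> H1 \<and> (\<lambda>z w. snd (X z w)) \<in> H1}"

definition has_partial_z ::
    "(quat \<Rightarrow> quat \<Rightarrow> quat) \<Rightarrow> quat \<Rightarrow> quat \<Rightarrow> quat \<Rightarrow> quat \<Rightarrow> bool" where
  "has_partial_z f z w h l \<longleftrightarrow>
     ((\<lambda>t::real. (1 / t) *\<^sub>R (f (z + t *\<^sub>R h) w - f z w)) \<longlongrightarrow> l) (at 0)"

definition has_partial_w ::
    "(quat \<Rightarrow> quat \<Rightarrow> quat) \<Rightarrow> quat \<Rightarrow> quat \<Rightarrow> quat \<Rightarrow> quat \<Rightarrow> bool" where
  "has_partial_w f z w h l \<longleftrightarrow>
     ((\<lambda>t::real. (1 / t) *\<^sub>R (f z (w + t *\<^sub>R h) - f z w)) \<longlongrightarrow> l) (at 0)"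

definition has_divergence ::
    "(quat \<Rightarrow> quat \<Rightarrow> quat \<times> quat) \<Rightarrow> (quat \<Rightarrow> quat \<Rightarrow> quat) \<Rightarrow> bool" where
  "has_divergence X D \<longleftrightarrow>
     (\<forall>z w h. \<exists>l m. has_partial_z (\<lambda>z w. fst (X z w)) z w h l \<and>
                    has_partial_w (\<lambda>z w. snd (X z w)) z w h m \<and>
                    l + m = h * D z w)"

definition lmult :: "quat \<Rightarrow> quat \<times> quat \<Rightarrow> quat \<times> quat" (infixr "*\<^sub>l" 75) where
  "c *\<^sub>l v = (c * fst v, c * snd v)"

definition rmult :: "quat \<times> quat \<Rightarrow> quat \<Rightarrow> quat \<times> quat" (infixl "*\<^sub>r" 75) where
  "v *\<^sub>r c = (fst v * c, snd v * c)"

end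

theory Submission
  imports Defs
begin

text \<open>
Let \<open>X = (f, g)\<close>. Comparing both sides of \<open>Div X [h] = h div X\<close> after scaling \<open>z\<close> and \<open>w\<close> by
independent real factors separates the bidegrees: if \<open>F\<close> is the part of \<open>f\<close> of bidegree
\<open>(p+1, q)\<close> and \<open>G\<close> the part of \<open>g\<close> of bidegree \<open>(p, q+1)\<close>, then
\<open>\<partial>\<^sub>z F [h] + \<partial>\<^sub>w G [h] = h D\<close> with \<open>D\<close> of bidegree \<open>(p, q)\<close>. The parts with \<open>p + 1 = 0\<close> or
\<open>q + 1 = 0\<close> are subject to no condition; they make up \<open>g\<^sub>0\<close> and \<open>f\<^sub>0\<close>.

One would like to compare the coefficients of the words in this equation, but different
combinations of words may define the same function: \<open>[z,w]\<close> is purely imaginary, so its square is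
real and \<open>[[z,w]\<^sup>2, z] = 0\<close>. The argument therefore only uses values of functions.

\<^item> If \<open>D = 0\<close>, Euler's identity gives \<open>\<partial>\<^sub>z F [w] = -(q+1) G\<close>, and the pair
  \<open>(\<partial>\<^sub>w F [z], -(p+2) F)\<close> is again divergence-free, with \<open>p\<close> raised and \<open>q\<close> lowered by one.
  Induction on \<open>q\<close> yields \<open>F = S\<^bsub>p+1,q\<^esub> e\<close>, \<open>G = -S\<^bsub>p,q+1\<^esub> e\<close> (\<open>divergence_free_wordfun\<close>).

\<^item> In general \<open>D = S\<^bsub>p,q\<^esub> c\<close> (\<open>divergence_wordfun\<close>). The real direction \<open>h = 1\<close> is what
  makes an induction on \<open>p + q\<close> possible: \<open>\<partial>\<^sub>z[1]\<close> and \<open>\<partial>\<^sub>w[1]\<close> turn words into sums of words,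
  and they map solutions to solutions of lower degree. Hence \<open>\<partial>\<^sub>z D [1]\<close> and \<open>\<partial>\<^sub>w D [1]\<close> are
  multiples of \<open>S\<close>. Subtracting a suitable field \<open>(z S\<^bsub>p,q\<^esub>, -z S\<^bsub>p-1,q+1\<^esub>) c\<close>, which has
  divergence \<open>S\<^bsub>p,q\<^esub> c\<close>, makes both of them vanish. Then the real derivatives of the field are
  divergence-free, hence known by the first case, and \<open>D = \<partial>\<^sub>z F [1] + \<partial>\<^sub>w G [1]\<close> is read off
  from them.

\<^item> Subtracting \<open>(z S\<^bsub>p,q\<^esub>, -z S\<^bsub>p-1,q+1\<^esub>) c\<close> once more leaves a divergence-free field
  \<open>(S\<^bsub>p+1,q\<^esub>, -S\<^bsub>p,q+1\<^esub>) b\<close>. With \<open>a = b + c\<close> and the recursion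
  \<open>S\<^bsub>p,q\<^esub> = z S\<^bsub>p-1,q\<^esub> + w S\<^bsub>p,q-1\<^esub>\<close> this is the asserted form.

It remains to justify the manipulation of the series. Absolute convergence is only given pointwise
and only for the series of homogeneous parts, whereas differentiating term by term and summing over
\<open>p\<close> and \<open>q\<close> separately need bounds on the coefficients. These come from \<open>coefficient_decay\<close>, about
polynomials \<open>g\<^sub>d\<close> of degree at most \<open>d\<close> in one real variable: if \<open>g\<^sub>d(s)\<close> tends to zero faster than
every geometric sequence for each single \<open>s\<close> in \<open>[0,1]\<close>, then so do the coefficients of \<open>g\<^sub>d\<close>,
uniformly. A set of measure more than one half carries a uniform bound, and the coefficients can be
recovered from the values at well separated points of such a set at the cost of a factor \<open>C\<^sup>d\<close>.
Applied to \<open>s \<mapsto> f\<^sub>d(s z, w)\<close> and \<open>s \<mapsto> f\<^sub>d(z + s h, w)\<close>, with \<open>f\<^sub>d\<close> the homogeneous part of degree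
\<open>d\<close>, it gives both kinds of bounds.
\<close>

section \<open>Directional derivatives of polynomial functions\<close>

definition dz :: "quat \<Rightarrow> (quat \<Rightarrow> quat \<Rightarrow> quat) \<Rightarrow> quat \<Rightarrow> quat \<Rightarrow> quat" where
  "dz h f z w = vector_derivative (\<lambda>t. f (z + t *\<^sub>R h) w) (at 0)"

definition dw :: "quat \<Rightarrow> (quat \<Rightarrow> quat \<Rightarrow> quat) \<Rightarrow> quat \<Rightarrow> quat \<Rightarrow> quat" where
  "dw h f z w = vector_derivative (\<lambda>t. f z (w + t *\<^sub>R h)) (at 0)"

text \<open>Directions \<open>h\<close> and constants may occur anywhere in such a function, so the class is closed under
all directional derivatives, unlike the class of functions given by words with coefficients on the
right.\<close>

inductive polyfun :: "(quat \<Rightarrow> quat \<Rightarrow> quat) \<Rightarrow> bool" where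
  const: "polyfun (\<lambda>z w. c)"
| fst: "polyfun (\<lambda>z w. z)"
| snd: "polyfun (\<lambda>z w. w)"
| add: "polyfun f \<Longrightarrow> polyfun g \<Longrightarrow> polyfun (\<lambda>z w. f z w + g z w)"
| mult: "polyfun f \<Longrightarrow> polyfun g \<Longrightarrow> polyfun (\<lambda>z w. f z w * g z w)"

lemma has_dz: "polyfun f \<Longrightarrow> ((\<lambda>t. f (z + t *\<^sub>R h) w) has_vector_derivative dz h f z w) (at 0)"
proof (unfold dz_def, rule vector_derivative_works [THEN iffD1])
  show "polyfun f \<Longrightarrow> (\<lambda>t. f (z + t *\<^sub>R h) w) differentiable at 0"
    by (induction rule: polyfun.induct) (auto intro!: derivative_intros)
qed

lemma has_dw: "polyfun f \<Longrightarrow> ((\<lambda>t. f z (w + t *\<^sub>R h)) has_vector_derivative dw h f z w) (at 0)"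
proof (unfold dw_def, rule vector_derivative_works [THEN iffD1])
  show "polyfun f \<Longrightarrow> (\<lambda>t. f z (w + t *\<^sub>R h)) differentiable at 0"
    by (induction rule: polyfun.induct) (auto intro!: derivative_intros)
qed

lemma dz_eqI: "((\<lambda>t. f (z + t *\<^sub>R h) w) has_vector_derivative l) (at 0) \<Longrightarrow> dz h f z w = l"
  unfolding dz_def by (rule vector_derivative_at)

lemma dw_eqI: "((\<lambda>t. f z (w + t *\<^sub>R h)) has_vector_derivative l) (at 0) \<Longrightarrow> dw h f z w = l"
  unfolding dw_def by (rule vector_derivative_at)

lemma dz_const [simp]: "dz h (\<lambda>z w. c) = (\<lambda>z w. 0)" "dz h (\<lambda>z w. w) = (\<lambda>z w. 0)"
  by (intro ext dz_eqI; simp)+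

lemma dw_const [simp]: "dw h (\<lambda>z w. c) = (\<lambda>z w. 0)" "dw h (\<lambda>z w. z) = (\<lambda>z w. 0)"
  by (intro ext dw_eqI; simp)+

lemma dz_fst [simp]: "dz h (\<lambda>z w. z) = (\<lambda>z w. h)"
  by (intro ext dz_eqI) (auto intro!: derivative_eq_intros)

lemma dw_snd [simp]: "dw h (\<lambda>z w. w) = (\<lambda>z w. h)"
  by (intro ext dw_eqI) (auto intro!: derivative_eq_intros)

lemma dz_add [simp]:
  assumes "polyfun f" "polyfun g"
  shows "dz h (\<lambda>z w. f z w + g z w) = (\<lambda>z w. dz h f z w + dz h g z w)"
  by (intro ext dz_eqI has_vector_derivative_add has_dz assms)

lemma dw_add [simp]:
  assumes "polyfun f" "polyfun g"
  shows "dw h (\<lambda>z w. f z w + g z w) = (\<lambda>z w. dw h f z w + dw h g z w)"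
  by (intro ext dw_eqI has_vector_derivative_add has_dw assms)

lemma dz_mult [simp]:
  assumes "polyfun f" "polyfun g"
  shows "dz h (\<lambda>z w. f z w * g z w) = (\<lambda>z w. f z w * dz h g z w + dz h f z w * g z w)"
  by (intro ext dz_eqI has_vector_derivative_eq_rhs
      [OF has_vector_derivative_mult [OF has_dz has_dz]] assms) simp

lemma dw_mult [simp]:
  assumes "polyfun f" "polyfun g"
  shows "dw h (\<lambda>z w. f z w * g z w) = (\<lambda>z w. f z w * dw h g z w + dw h f z w * g z w)"
  by (intro ext dw_eqI has_vector_derivative_eq_rhs
      [OF has_vector_derivative_mult [OF has_dw has_dw]] assms) simp

declare polyfun.intros [intro!, simp]

lemma polyfun_uminus [intro!, simp]: "polyfun f \<Longrightarrow> polyfun (\<lambda>z w. - f z w)"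
  using polyfun.mult [OF polyfun.const [of "-1"]] by simp

lemma polyfun_diff [intro!, simp]:
  "polyfun f \<Longrightarrow> polyfun g \<Longrightarrow> polyfun (\<lambda>z w. f z w - g z w)"
  using polyfun.add [OF _ polyfun_uminus] by simp

lemma dz_uminus [simp]: "polyfun f \<Longrightarrow> dz h (\<lambda>z w. - f z w) = (\<lambda>z w. - dz h f z w)"
  using dz_mult [OF polyfun.const [of "-1"]] by simp

lemma dw_uminus [simp]: "polyfun f \<Longrightarrow> dw h (\<lambda>z w. - f z w) = (\<lambda>z w. - dw h f z w)"
  using dw_mult [OF polyfun.const [of "-1"]] by simp

lemma dz_diff [simp]:
  "polyfun f \<Longrightarrow> polyfun g \<Longrightarrow>
    dz h (\<lambda>z w. f z w - g z w) = (\<lambda>z w. dz h f z w - dz h g z w)"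
  using dz_add [OF _ polyfun_uminus, of f g] by simp

lemma dw_diff [simp]:
  "polyfun f \<Longrightarrow> polyfun g \<Longrightarrow>
    dw h (\<lambda>z w. f z w - g z w) = (\<lambda>z w. dw h f z w - dw h g z w)"
  using dw_add [OF _ polyfun_uminus, of f g] by simp

lemma polyfun_dz [intro!, simp]: "polyfun f \<Longrightarrow> polyfun (dz h f)"
  by (induction rule: polyfun.induct) auto

lemma polyfun_dw [intro!, simp]: "polyfun f \<Longrightarrow> polyfun (dw h f)"
  by (induction rule: polyfun.induct) auto

lemma dz_dz_commute: "polyfun f \<Longrightarrow> dz h (dz k f) = dz k (dz h f)"
  by (induction rule: polyfun.induct) (auto simp: algebra_simps)

lemma dw_dw_commute: "polyfun f \<Longrightarrow> dw h (dw k f) = dw k (dw h f)"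
  by (induction rule: polyfun.induct) (auto simp: algebra_simps)

lemma dw_dz_commute: "polyfun f \<Longrightarrow> dw h (dz k f) = dz k (dw h f)"
  by (induction rule: polyfun.induct) (auto simp: algebra_simps)

lemma polyfun_raise [intro!, simp]: "polyfun f \<Longrightarrow> polyfun (\<lambda>z w. dw z f z w)"
  by (induction rule: polyfun.induct) auto

text \<open>The direction of \<open>\<partial>\<^sub>w f [z]\<close> moves with the point; its own derivative is the first summand on the
right.\<close>

lemma dz_raise:
  "polyfun f \<Longrightarrow>
    dz h (\<lambda>z w. dw z f z w) = (\<lambda>z w. dw h f z w + dw z (dz h f) z w)"
  by (induction rule: polyfun.induct) (auto simp: algebra_simps)

section \<open>Word functions\<close>

text \<open>The finite sums of words with \<open>p\<close> letters \<open>z\<close>, \<open>q\<close> letters \<open>w\<close> and coefficients on the right,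
as functions. Many coefficient families give the same function, so the coefficients are not
recorded.\<close>

inductive wordfun :: "nat \<Rightarrow> nat \<Rightarrow> (quat \<Rightarrow> quat \<Rightarrow> quat) \<Rightarrow> bool" where
  const: "wordfun 0 0 (\<lambda>z w. c)"
| mult_z: "wordfun p q f \<Longrightarrow> wordfun (Suc p) q (\<lambda>z w. z * f z w)"
| mult_w: "wordfun p q f \<Longrightarrow> wordfun p (Suc q) (\<lambda>z w. w * f z w)"
| add: "wordfun p q f \<Longrightarrow> wordfun p q g \<Longrightarrow> wordfun p q (\<lambda>z w. f z w + g z w)"

lemma wordfun_polyfun [simp]: "wordfun p q f \<Longrightarrow> polyfun f"
  by (induction rule: wordfun.induct) auto

lemma wordfun_mult_right: "wordfun p q f \<Longrightarrow> wordfun p q (\<lambda>z w. f z w * c)"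
  by (induction rule: wordfun.induct) (auto simp: mult.assoc distrib_right intro: wordfun.intros)

lemma wordfun_uminus: "wordfun p q f \<Longrightarrow> wordfun p q (\<lambda>z w. - f z w)"
  using wordfun_mult_right [of p q f "-1"] by simp

lemma wordfun_diff:
  "wordfun p q f \<Longrightarrow> wordfun p q g \<Longrightarrow> wordfun p q (\<lambda>z w. f z w - g z w)"
  using wordfun.add [OF _ wordfun_uminus] by simp

lemma wordfun_zero: "wordfun p q (\<lambda>z w. 0)"
proof (induction p)
  case 0
  show ?case
  proof (induction q)
    case 0
    show ?case by (rule wordfun.const)
  next
    case (Suc q)
    from wordfun.mult_w [OF this] show ?case by simp
  qed
next
  case (Suc p)
  from wordfun.mult_z [OF this] show ?case by simp
qed

lemma wordfun_sum:
  "finite A \<Longrightarrow> (\<And>i. i \<in> A \<Longrightarrow> wordfun p q (f i)) \<Longrightarrow> wordfun p q (\<lambda>z w. \<Sum>i\<in>A. f i z w)"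
  by (induction rule: finite_induct) (auto intro: wordfun_zero wordfun.add)

lemma wordfun_dz_0: "wordfun p q f \<Longrightarrow> p = 0 \<Longrightarrow> dz h f = (\<lambda>z w. 0)"
  by (induction rule: wordfun.induct) auto

lemma wordfun_dw_0: "wordfun p q f \<Longrightarrow> q = 0 \<Longrightarrow> dw h f = (\<lambda>z w. 0)"
  by (induction rule: wordfun.induct) auto

text \<open>For a direction \<open>h\<close> outside the reals the derivative has \<open>h\<close> inside its words and is, in general, not in
the class.\<close>

lemma wordfun_dz_1: "wordfun p q f \<Longrightarrow> wordfun (p - 1) q (dz 1 f)"
proof (induction rule: wordfun.induct)
  case (mult_z p q f)
  show ?case
  proof (cases p)
    case 0
    with mult_z show ?thesis by (simp add: wordfun_dz_0)
  next
    case (Suc p')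
    with mult_z wordfun.mult_z [OF mult_z.IH] show ?thesis
      by (auto intro: wordfun.add)
  qed
qed (auto intro: wordfun.intros)

lemma wordfun_dw_1: "wordfun p q f \<Longrightarrow> wordfun p (q - 1) (dw 1 f)"
proof (induction rule: wordfun.induct)
  case (mult_w p q f)
  show ?case
  proof (cases q)
    case 0
    with mult_w show ?thesis by (simp add: wordfun_dw_0)
  next
    case (Suc q')
    with mult_w wordfun.mult_w [OF mult_w.IH] show ?thesis
      by (auto intro: wordfun.add)
  qed
qed (auto intro: wordfun.intros)

text \<open>Differentiating in the direction \<open>z\<close> replaces one letter \<open>w\<close> at a time by \<open>z\<close>.\<close>

lemma wordfun_raise: "wordfun p q f \<Longrightarrow> wordfun (Suc p) (q - 1) (\<lambda>z w. dw z f z w)"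
proof (induction rule: wordfun.induct)
  case (mult_w p q f)
  show ?case
  proof (cases q)
    case 0
    with mult_w show ?thesis
      by (auto simp add: wordfun_dw_0 intro: wordfun.intros)
  next
    case (Suc q')
    with mult_w wordfun.mult_w [OF mult_w.IH] wordfun.mult_z [OF mult_w.hyps] show ?thesis
      by (auto intro: wordfun.add)
  qed
qed (auto intro: wordfun.intros wordfun_zero)

lemma euler_z: "wordfun p q f \<Longrightarrow> dz z f z w = of_nat p * f z w"
  by (induction rule: wordfun.induct) (auto simp: algebra_simps mult_of_nat_commute)

lemma euler_w: "wordfun p q f \<Longrightarrow> dw w f z w = of_nat q * f z w"
  by (induction rule: wordfun.induct) (auto simp: algebra_simps mult_of_nat_commute)

lemma wordfun_w_0: "wordfun p q f \<Longrightarrow> q = 0 \<Longrightarrow> \<exists>c. f = (\<lambda>z w. z ^ p * c)"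
proof (induction rule: wordfun.induct)
  case (mult_z p q f)
  then show ?case by (auto simp: mult.assoc)
next
  case (add p q f g)
  then obtain c d where "f = (\<lambda>z w. z ^ p * c)" "g = (\<lambda>z w. z ^ p * d)" by blast
  then show ?case by (auto simp flip: distrib_left)
qed auto

lemma wordfun_z_0: "wordfun p q f \<Longrightarrow> p = 0 \<Longrightarrow> \<exists>c. f = (\<lambda>z w. w ^ q * c)"
proof (induction rule: wordfun.induct)
  case (mult_w p q f)
  then show ?case by (auto simp: mult.assoc)
next
  case (add p q f g)
  then obtain c d where "f = (\<lambda>z w. w ^ q * c)" "g = (\<lambda>z w. w ^ q * d)" by blast
  then show ?case by (auto simp flip: distrib_left)
qed auto

lemma wordfun_scale:
  "wordfun p q f \<Longrightarrow> f (s *\<^sub>R z) (t *\<^sub>R w) = (s ^ p * t ^ q) *\<^sub>R f z w"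
  by (induction rule: wordfun.induct) (auto simp: algebra_simps)

lemma dz_scale:
  "wordfun p q f \<Longrightarrow> s *\<^sub>R dz h f (s *\<^sub>R z) (t *\<^sub>R w) = (s ^ p * t ^ q) *\<^sub>R dz h f z w"
proof (induction rule: wordfun.induct)
  case (mult_z p q f)
  then show ?case using wordfun_scale [OF mult_z.hyps, of s z t w]
    by (simp add: algebra_simps flip: mult_scaleR_right)
next
  case (mult_w p q f)
  have "s *\<^sub>R dz h (\<lambda>z w. w * f z w) (s *\<^sub>R z) (t *\<^sub>R w)
      = (t *\<^sub>R w) * (s *\<^sub>R dz h f (s *\<^sub>R z) (t *\<^sub>R w))"
    using mult_w.hyps by simp
  with mult_w show ?case by (simp add: algebra_simps)
qed (auto simp: algebra_simps)

lemma dw_scale: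
  "wordfun p q f \<Longrightarrow> t *\<^sub>R dw h f (s *\<^sub>R z) (t *\<^sub>R w) = (s ^ p * t ^ q) *\<^sub>R dw h f z w"
proof (induction rule: wordfun.induct)
  case (mult_w p q f)
  then show ?case using wordfun_scale [OF mult_w.hyps, of s z t w]
    by (simp add: algebra_simps flip: mult_scaleR_right)
next
  case (mult_z p q f)
  have "t *\<^sub>R dw h (\<lambda>z w. z * f z w) (s *\<^sub>R z) (t *\<^sub>R w)
      = (s *\<^sub>R z) * (t *\<^sub>R dw h f (s *\<^sub>R z) (t *\<^sub>R w))"
    using mult_z.hyps by simp
  with mult_z show ?case by (simp add: algebra_simps)
qed (auto simp: algebra_simps)

section \<open>The functions S\<close>

definition words :: "int \<Rightarrow> int \<Rightarrow> bool list set" where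
  "words p q = {\<alpha>. int (length \<alpha>) = p + q \<and> int (weight \<alpha>) = p}"

lemma S_words: "S p q z w = (\<Sum>\<alpha>\<in>words p q. word z w \<alpha>)"
  by (simp add: S_def words_def)

lemma finite_words [simp]: "finite (words p q)"
proof (rule finite_subset)
  show "words p q \<subseteq> {xs. set xs \<subseteq> UNIV \<and> length xs = nat (p + q)}"
    by (auto simp: words_def simp flip: nat_int)
qed (rule finite_lists_length_eq, simp)

lemma weight_le: "weight \<alpha> \<le> length \<alpha>"
  by (simp add: weight_def)

lemma words_neg: "p < 0 \<or> q < 0 \<Longrightarrow> words p q = {}"
proof -
  have False if "p < 0 \<or> q < 0" "\<alpha> \<in> words p q" for \<alpha>
    using that weight_le [of \<alpha>] by (auto simp: words_def)
  then show "p < 0 \<or> q < 0 \<Longrightarrow> words p q = {}" by blast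
qed

lemma words_0: "words 0 0 = {[]}"
  by (auto simp: words_def weight_def)

lemma words_Cons:
  assumes "p + q > 0"
  shows "words p q = (#) True ` words (p - 1) q \<union> (#) False ` words p (q - 1)"
proof (intro equalityI subsetI)
  fix \<alpha> assume \<alpha>: "\<alpha> \<in> words p q"
  with assms obtain x \<beta> where "\<alpha> = x # \<beta>" by (cases \<alpha>) (auto simp: words_def)
  with \<alpha> show "\<alpha> \<in> (#) True ` words (p - 1) q \<union> (#) False ` words p (q - 1)"
    by (cases x) (auto simp: words_def weight_def)
qed (use assms in \<open>auto simp: words_def weight_def\<close>)

lemma S_neg: "p < 0 \<or> q < 0 \<Longrightarrow> S p q z w = 0"
  by (simp add: S_words words_neg)

lemma S_0: "S 0 0 z w = 1"
  by (simp add: S_words words_0 word_def)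

lemma S_rec:
  assumes "p + q > 0"
  shows "S p q = (\<lambda>z w. z * S (p - 1) q z w + w * S p (q - 1) z w)"
proof (intro ext)
  fix z w
  have "S p q z w = (\<Sum>\<alpha>\<in>(#) True ` words (p - 1) q. word z w \<alpha>)
      + (\<Sum>\<alpha>\<in>(#) False ` words p (q - 1). word z w \<alpha>)"
    unfolding S_words words_Cons [OF assms] by (rule sum.union_disjoint) auto
  then show "S p q z w = z * S (p - 1) q z w + w * S p (q - 1) z w"
    by (simp add: sum.reindex S_words word_def sum_distrib_left)
qed

text \<open>The recursion of \<open>S\<close> lowers one index by one; negative indices are admitted so that the summands
missing at the boundary need no separate treatment.\<close>

lemma S_induct [case_names nonpos rec]:
  assumes "\<And>p q. p + q \<le> 0 \<Longrightarrow> P p q"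
    and "\<And>p q. p + q > 0 \<Longrightarrow> P (p - 1) q \<Longrightarrow> P p (q - 1) \<Longrightarrow> P p q"
  shows "P (p::int) (q::int)"
proof (induction "nat (p + q)" arbitrary: p q)
  case 0
  then show ?case by (intro assms(1)) simp
next
  case (Suc n)
  then have "n = nat (p - 1 + q)" "n = nat (p + (q - 1))" "p + q > 0" by auto
  then show ?case using assms(2) Suc.hyps(1) by blast
qed

lemma S_nonpos:
  assumes "p + q \<le> 0"
  shows "S p q = (\<lambda>z w. if p = 0 \<and> q = 0 then 1 else 0)"
proof (cases "p = 0 \<and> q = 0")
  case False
  with assms have "p < 0 \<or> q < 0" by linarith
  with False show ?thesis by (auto simp: fun_eq_iff S_neg)
qed (simp add: fun_eq_iff S_0)

lemma polyfun_S [simp]: "polyfun (S p q)"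
proof (induction p q rule: S_induct)
  case (nonpos p q)
  then show ?case by (cases "p = 0 \<and> q = 0") (simp_all add: S_nonpos)
next
  case (rec p q)
  then show ?case by (simp add: S_rec [of p q])
qed

lemma wordfun_S: "wordfun p q (S (int p) (int q))"
proof -
  have "wordfun (nat i) (nat j) (S i j)" for i j
  proof (induction i j rule: S_induct)
    case (nonpos i j)
    show ?case
    proof (cases "i = 0 \<and> j = 0")
      case True
      then show ?thesis using wordfun.const [of 1] by (simp add: S_nonpos)
    next
      case False
      then have "S i j = (\<lambda>z w. 0)" using nonpos by (auto simp: S_nonpos)
      then show ?thesis by (simp add: wordfun_zero)
    qed
  next
    case (rec i j)
    have "wordfun (nat i) (nat j) (\<lambda>z w. z * S (i - 1) j z w)"
    proof (cases "i > 0")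
      case True
      then have Suc_nat_i: "Suc (nat (i - 1)) = nat i" by simp
      show ?thesis using wordfun.mult_z [OF rec.IH(1)] Suc_nat_i by simp
    qed (simp add: S_neg wordfun_zero)
    moreover have "wordfun (nat i) (nat j) (\<lambda>z w. w * S i (j - 1) z w)"
    proof (cases "j > 0")
      case True
      then have Suc_nat_j: "Suc (nat (j - 1)) = nat j" by simp
      show ?thesis using wordfun.mult_w [OF rec.IH(2)] Suc_nat_j by simp
    qed (simp add: S_neg wordfun_zero)
    ultimately show ?case
      unfolding S_rec [OF rec.hyps] by (rule wordfun.add)
  qed
  from this [of "int p" "int q"] show ?thesis by simp
qed

text \<open>Both sides are the sum of all words with \<open>p - 1\<close> letters \<open>z\<close>, \<open>q\<close> letters \<open>w\<close> and one letter
\<open>h\<close>. This is why \<open>(S\<^bsub>p,q\<^esub>, -S\<^bsub>p-1,q+1\<^esub>)\<close> is divergence-free.\<close>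

lemma dz_S_eq_dw_S: "dz h (S p q) = dw h (S (p - 1) (q + 1))"
proof (induction p q rule: S_induct)
  case (nonpos p q)
  then show ?case by (simp add: S_nonpos)
next
  case (rec p q)
  have "S (p - 1) (q + 1) = (\<lambda>z w. z * S (p - 1 - 1) (q + 1) z w + w * S (p - 1) q z w)"
    using rec.hyps S_rec [of "p - 1" "q + 1"] by simp
  with rec show ?case
    by (simp add: S_rec [of p q] algebra_simps)
qed

text \<open>Erasing a letter \<open>z\<close> from a word with \<open>p + q\<close> letters: every shorter word arises by inserting
\<open>z\<close> at one of \<open>p + q\<close> places.\<close>

lemma dz_1_S: "dz 1 (S p q) = (\<lambda>z w. of_int (p + q) * S (p - 1) q z w)"
proof (induction p q rule: S_induct)
  case (nonpos p q)
  then show ?case by (auto simp: S_nonpos fun_eq_iff)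
next
  case (rec p q)
  have *: "z * (of_int (p - 1 + q) * S (p - 1 - 1) q z w)
        + w * (of_int (p + (q - 1)) * S (p - 1) (q - 1) z w)
      = of_int (p + q - 1) * S (p - 1) q z w" for z w
  proof (cases "p + q = 1")
    case True
    then have "p - 1 + q = 0" "p + (q - 1) = 0" "p + q - 1 = 0" by auto
    then show ?thesis by (simp only: of_int_0) simp
  next
    case False
    with rec.hyps have S1: "S (p - 1) q z w = z * S (p - 1 - 1) q z w + w * S (p - 1) (q - 1) z w"
      using S_rec [of "p - 1" q] by (simp add: fun_eq_iff)
    have c: "x * (of_int n * y) = of_int n * (x * y)" for x y :: quat and n
      by (metis mult.assoc mult_of_int_commute)
    have "p - 1 + q = p + q - 1" "p + (q - 1) = p + q - 1" by auto
    then show ?thesis unfolding S1 by (simp only: c distrib_left)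
  qed
  have "dz 1 (S p q) z w = S (p - 1) q z w + of_int (p + q - 1) * S (p - 1) q z w" for z w
    using rec *[of z w] by (simp add: S_rec [of p q])
  then show ?case by (simp add: fun_eq_iff algebra_simps)
qed

lemma dw_1_S: "dw 1 (S p q) = (\<lambda>z w. of_int (p + q) * S p (q - 1) z w)"
  using dz_S_eq_dw_S [of 1 "p + 1" "q - 1"] dz_1_S [of "p + 1" "q - 1"] by simp

lemma dz_w_S: "dz w (S (int (Suc p)) (int q)) z w = of_nat (Suc q) * S (int p) (int (Suc q)) z w"
  using euler_w [OF wordfun_S [of p "Suc q"]] dz_S_eq_dw_S [of w "int (Suc p)" "int q"]
  by (simp add: algebra_simps)

lemma S_1_1: "S (int p) (int q) 1 1 = of_nat (card (words (int p) (int q)))"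
  "card (words (int p) (int q)) > 0"
proof -
  have [simp]: "word 1 1 \<alpha> = 1" for \<alpha>
    by (induction \<alpha>) (auto simp: word_def)
  show "S (int p) (int q) 1 1 = of_nat (card (words (int p) (int q)))"
    by (simp add: S_words)
  have "replicate p True @ replicate q False \<in> words (int p) (int q)"
    by (simp add: words_def weight_def)
  then show "card (words (int p) (int q)) > 0"
    by (auto simp: card_gt_0_iff)
qed

text \<open>The value is the number of words. The bound allows cancelling the value of \<open>S\<close> at \<open>(1, 1)\<close> in
identities and estimates.\<close>

lemma norm_S_1_1: "norm (S (int p) (int q) 1 1) \<ge> 1"
  using S_1_1 [of p q] by simp

lemma norm_S_le: "norm (S p q z w) \<le> (norm z + norm w) ^ nat (p + q)"
proof (induction p q rule: S_induct)
  case (nonpos p q)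
  then show ?case by (simp add: S_nonpos)
next
  case (rec p q)
  define n where "n = nat (p + q) - 1"
  from rec.hyps have n: "nat (p + q) = Suc n" "nat (p - 1 + q) = n" "nat (p + (q - 1)) = n"
    by (auto simp: n_def)
  have "norm (S p q z w) \<le> norm z * norm (S (p - 1) q z w) + norm w * norm (S p (q - 1) z w)"
    by (metis S_rec [OF rec.hyps] norm_mult norm_triangle_ineq)
  also have "\<dots> \<le> norm z * (norm z + norm w) ^ n + norm w * (norm z + norm w) ^ n"
    using rec.IH n by (intro add_mono mult_left_mono) auto
  finally show ?case by (simp add: n algebra_simps)
qed

section \<open>Bihomogeneous vector fields with divergence\<close>

lemma wordfun_one_letter:
  assumes f: "wordfun p q f" and "p = 0 \<or> q = 0"
  shows "\<exists>c. f = (\<lambda>z w. S (int p) (int q) z w * c)"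
proof -
  have S: "wordfun p q (S (int p) (int q))" by (rule wordfun_S)
  obtain m :: "quat \<Rightarrow> quat \<Rightarrow> quat" and c d
    where m: "f = (\<lambda>z w. m z w * c)" "S (int p) (int q) = (\<lambda>z w. m z w * d)"
  proof (cases "p = 0")
    case True
    with wordfun_z_0 [OF f] wordfun_z_0 [OF S] that [of "\<lambda>z w. w ^ q"] show ?thesis by blast
  next
    case False
    with assms wordfun_w_0 [OF f] wordfun_w_0 [OF S] that [of "\<lambda>z w. z ^ p"] show ?thesis by blast
  qed
  have "d \<noteq> 0"
    using norm_S_1_1 [of p q] m by auto
  then have "m z w * c = m z w * d * (inverse d * c)" for z w
    by (metis mult.assoc mult.left_neutral right_inverse)
  with m show ?thesis by (auto simp: fun_eq_iff)
qed

text \<open>Once \<open>F\<close> is known, Euler's identity \<open>(q+1) G = \<partial>\<^sub>w G [w] = -\<partial>\<^sub>z F [w]\<close> gives \<open>G\<close>. To find \<open>F\<close>,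
the symmetry of second derivatives shows that \<open>(\<partial>\<^sub>w F [z], -(p+2) F)\<close> is again divergence-free;
its bidegrees have a smaller \<open>q\<close>, and its second component is \<open>F\<close> up to a factor.\<close>

lemma divergence_free_wordfun:
  assumes "wordfun (Suc p) q F" "wordfun p (Suc q) G"
    and "\<And>h z w. dz h F z w + dw h G z w = 0"
  shows "\<exists>e. F = (\<lambda>z w. S (int (Suc p)) (int q) z w * e)
    \<and> G = (\<lambda>z w. - S (int p) (int (Suc q)) z w * e)"
  using assms
proof (induction q arbitrary: p F G)
  have G: "G = (\<lambda>z w. - S (int p) (int (Suc q)) z w * e)"
    if F: "F = (\<lambda>z w. S (int (Suc p)) (int q) z w * e)" and G: "wordfun p (Suc q) G"
      and eq: "\<And>h z w. dz h F z w + dw h G z w = 0" for p q F G e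
  proof (intro ext)
    fix z w
    have "of_nat (Suc q) * G z w = - dz w F z w"
      using euler_w [OF G, of w z] eq [of w z w] by (simp add: eq_neg_iff_add_eq_0 add.commute)
    also have "dz w F z w = of_nat (Suc q) * (S (int p) (int (Suc q)) z w * e)"
      using dz_w_S [of w p q z] by (simp add: F mult.assoc del: of_nat_Suc)
    finally have "of_nat (Suc q) * (G z w + S (int p) (int (Suc q)) z w * e) = 0"
      by (simp only: distrib_left) simp
    then have "G z w + S (int p) (int (Suc q)) z w * e = 0"
      by (metis mult_eq_0_iff of_nat_eq_0_iff nat.distinct(1))
    then show "G z w = - S (int p) (int (Suc q)) z w * e"
      by (simp add: eq_neg_iff_add_eq_0)
  qed
  {
    case 0
    then obtain e where "F = (\<lambda>z w. S (int (Suc p)) (int 0) z w * e)"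
      using wordfun_one_letter [of "Suc p" 0 F] by blast
    with G [OF this 0(2,3)] show ?case by blast
  next
    case (Suc q)
    note [simp] = wordfun_polyfun [OF Suc.prems(1)] wordfun_polyfun [OF Suc.prems(2)]
    have dF: "dz h F = (\<lambda>z w. - dw h G z w)" for h
      using Suc.prems(3) [of h] by (simp add: fun_eq_iff eq_neg_iff_add_eq_0)
    have dG: "dw h G = (\<lambda>z w. - dz h F z w)" for h
      using dF [of h] by simp
    define F' where "F' = (\<lambda>z w. dw z F z w)"
    define G' where "G' = (\<lambda>z w. F z w * (- of_nat (Suc (Suc p))))"
    have "dz h F' z w + dw h G' z w = 0" for h z w
    proof -
      \<comment> \<open>The direction \<open>z\<close> is held fixed in the outer derivative with respect to \<open>w\<close>, so Euler's
        identity may be applied inside it.\<close>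
      have "dw z (dz h F) z w = dw h (dz z F) z w"
        by (simp add: dF dw_dw_commute [of G])
      also have "\<dots> = dw h (\<lambda>z w. of_nat (Suc p) * F z w) z w"
        unfolding dw_def [of h] by (simp only: euler_z [OF Suc.prems(1)])
      also have "\<dots> = of_nat (Suc p) * dw h F z w"
        by (simp del: of_nat_Suc)
      finally have "dz h F' z w = of_nat (Suc (Suc p)) * dw h F z w"
        by (simp add: F'_def dz_raise algebra_simps)
      also have "\<dots> = dw h F z w * of_nat (Suc (Suc p))"
        by (rule mult_of_nat_commute)
      finally show ?thesis by (simp add: G'_def del: of_nat_Suc)
    qed
    moreover have "wordfun (Suc (Suc p)) q F'" "wordfun (Suc p) (Suc q) G'"
      using wordfun_raise [OF Suc.prems(1)]
      unfolding F'_def G'_def by (simp, intro wordfun_mult_right Suc.prems)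
    ultimately obtain e where
      "G' = (\<lambda>z w. - S (int (Suc p)) (int (Suc q)) z w * e)"
      using Suc.IH [of "Suc p" F' G'] by blast
    then have "F z w * of_nat (Suc (Suc p)) = S (int (Suc p)) (int (Suc q)) z w * e" for z w
      by (simp add: G'_def fun_eq_iff del: of_nat_Suc)
    moreover have "(of_nat (Suc (Suc p)) :: quat) \<noteq> 0"
      by (metis nat.distinct(1) of_nat_eq_0_iff)
    ultimately have "F = (\<lambda>z w. S (int (Suc p)) (int (Suc q)) z w * (e / of_nat (Suc (Suc p))))"
      by (simp add: fun_eq_iff eq_divide_eq del: of_nat_Suc)
    with G [OF this Suc.prems(2,3)] show ?case by blast
  }
qed

text \<open>By induction the real derivatives of \<open>D\<close> are \<open>S\<^bsub>p-1,q\<^esub> c\<^sub>1\<close> and \<open>S\<^bsub>p,q-1\<^esub> c\<^sub>2\<close>; comparing mixed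
derivatives gives \<open>c\<^sub>1 = c\<^sub>2\<close>, so that \<open>S\<^bsub>p,q\<^esub> c\<close> with \<open>c = c\<^sub>1 / (p+q)\<close> has the same real
derivatives. After subtracting a field with this divergence, the real derivatives of the field are
divergence-free and \<open>D\<close> is a sum of two of their components.\<close>

lemma divergence_wordfun:
  assumes "wordfun (Suc p) q F" "wordfun p (Suc q) G"
    and "\<And>h z w. dz h F z w + dw h G z w = h * D z w"
  shows "\<exists>c. D = (\<lambda>z w. S (int p) (int q) z w * c)"
  using assms
proof (induction "p + q" arbitrary: p q F G D rule: less_induct)
  case less
  note F [simp] = wordfun_polyfun [OF less.prems(1)]
  note G [simp] = wordfun_polyfun [OF less.prems(2)]
  have D_eq: "D = (\<lambda>z w. dz 1 F z w + dw 1 G z w)"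
    using less.prems(3) [of 1] by simp
  have D: "wordfun p q D"
    unfolding D_eq using wordfun_dz_1 [OF less.prems(1)] wordfun_dw_1 [OF less.prems(2)]
    by (auto intro: wordfun.add)
  note [simp] = wordfun_polyfun [OF D]
  have eq: "(\<lambda>z w. dz h F z w + dw h G z w) = (\<lambda>z w. h * D z w)" for h
    using less.prems(3) by simp
  show ?case
  proof (cases "p = 0 \<or> q = 0")
    case True
    then show ?thesis using wordfun_one_letter [OF D] by blast
  next
    case False
    then obtain p' q' where p: "p = Suc p'" and q: "q = Suc q'"
      by (metis not0_implies_Suc)
    have z_shift: "wordfun (Suc p') q (dz 1 F)" "wordfun p' (Suc q) (dz 1 G)"
      and w_shift: "wordfun (Suc p) q' (dw 1 F)" "wordfun p (Suc q') (dw 1 G)"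
      using wordfun_dz_1 [OF less.prems(1)] wordfun_dz_1 [OF less.prems(2)]
        wordfun_dw_1 [OF less.prems(1)] wordfun_dw_1 [OF less.prems(2)] by (auto simp: p q)
    have "dz h (dz 1 F) z w + dw h (dz 1 G) z w = h * dz 1 D z w" for h z w
      using arg_cong [OF eq [of h], of "dz 1"]
      by (simp add: fun_eq_iff dz_dz_commute [of F h] dw_dz_commute [of G h])
    with less.hyps [OF _ z_shift, of "dz 1 D"] obtain c1 where c1: "dz 1 D = (\<lambda>z w. S (int p') (int q) z w * c1)"
      by (auto simp: p)
    have "dz h (dw 1 F) z w + dw h (dw 1 G) z w = h * dw 1 D z w" for h z w
      using arg_cong [OF eq [of h], of "dw 1"]
      by (simp add: fun_eq_iff dw_dw_commute [of G h] dw_dz_commute [of F 1])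
    with less.hyps [OF _ w_shift, of "dw 1 D"] obtain c2 where c2: "dw 1 D = (\<lambda>z w. S (int p) (int q') z w * c2)"
      by (auto simp: q)
    let ?n = "of_nat (p + q) :: quat"
    have n_nz: "?n \<noteq> 0"
      by (simp add: p q del: of_nat_add of_nat_Suc)
    have "c1 = c2"
    proof -
      have "dw 1 (dz 1 D) 1 1 = dz 1 (dw 1 D) 1 1"
        by (simp add: dw_dz_commute)
      then have "of_int (int p' + int q) * S (int p') (int q') 1 1 * c1
          = of_int (int p + int q') * S (int p') (int q') 1 1 * c2"
        unfolding c1 c2 by (simp add: dz_1_S dw_1_S p q del: of_int_add)
      moreover have "int p' + int q = int p + int q'" by (simp add: p q)
      moreover have "(of_int (int p + int q') :: quat) \<noteq> 0"
        using p by (simp del: of_int_add)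
      moreover have "S (int p') (int q') 1 1 \<noteq> 0"
        using norm_S_1_1 [of p' q'] by auto
      ultimately show ?thesis by simp
    qed
    \<comment> \<open>The field \<open>(z S\<^bsub>p,q\<^esub>, -z S\<^bsub>p-1,q+1\<^esub>) c\<close> that is subtracted here has divergence
      \<open>S\<^bsub>p,q\<^esub> c\<close>: the first factor \<open>z\<close> contributes \<open>h S\<^bsub>p,q\<^esub> c\<close>, and the derivatives of
      the two \<open>S\<close> cancel by \<open>dz_S_eq_dw_S\<close>.\<close>
    define c where "c = inverse ?n * c1"
    define F' where "F' = (\<lambda>z w. F z w - z * S (int p) (int q) z w * c)"
    define G' where "G' = (\<lambda>z w. G z w + z * S (int p - 1) (int q + 1) z w * c)"
    define D' where "D' = (\<lambda>z w. D z w - S (int p) (int q) z w * c)"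
    have F' [simp]: "wordfun (Suc p) q F'"
      unfolding F'_def
      by (intro wordfun_diff wordfun_mult_right wordfun.mult_z wordfun_S less.prems)
    have "wordfun p (Suc q) (\<lambda>z w. z * S (int p - 1) (int q + 1) z w)"
      using wordfun.mult_z [OF wordfun_S [of p' "Suc q"]] by (simp add: p algebra_simps)
    then have G' [simp]: "wordfun p (Suc q) G'"
      unfolding G'_def by (intro wordfun.add wordfun_mult_right less.prems)
    note [simp] = wordfun_polyfun [OF F'] wordfun_polyfun [OF G']
    have [simp]: "polyfun D'" by (simp add: D'_def)
    have "dz h F' z w + dw h G' z w = h * D' z w" for h z w
      using less.prems(3) [of h z w]
      by (simp add: F'_def G'_def D'_def dz_S_eq_dw_S algebra_simps)
    then have eq': "(\<lambda>z w. dz h F' z w + dw h G' z w) = (\<lambda>z w. h * D' z w)" for h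
      by simp
    have n_c: "of_int (int p + int q) * x * c = x * c1" for x
    proof -
      have "?n * x * c = x * (?n * c)"
        by (simp only: mult_of_nat_commute [of "p + q" x] mult.assoc)
      also have "?n * c = c1"
        unfolding c_def mult.assoc [symmetric] right_inverse [OF n_nz] by simp
      finally show ?thesis by simp
    qed
    have D'_z: "dz 1 D' = (\<lambda>z w. 0)"
      unfolding D'_def by (simp add: c1 dz_1_S n_c del: of_int_add) (simp add: p)
    have D'_w: "dw 1 D' = (\<lambda>z w. 0)"
      unfolding D'_def by (simp add: c2 dw_1_S n_c \<open>c1 = c2\<close> del: of_int_add) (simp add: q)
    have "dz h (dz 1 F') z w + dw h (dz 1 G') z w = 0" for h z w
      using arg_cong [OF eq' [of h], of "dz 1"]
      by (simp add: fun_eq_iff dz_dz_commute [of F' h] dw_dz_commute [of G' h] D'_z)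
    moreover have "wordfun (Suc p') q (dz 1 F')" "wordfun p' (Suc q) (dz 1 G')"
      using wordfun_dz_1 [OF F'] wordfun_dz_1 [OF G'] by (auto simp: p)
    ultimately obtain e1 where e1: "dz 1 F' = (\<lambda>z w. S (int p) (int q) z w * e1)"
      using divergence_free_wordfun p by blast
    have "dz h (dw 1 F') z w + dw h (dw 1 G') z w = 0" for h z w
      using arg_cong [OF eq' [of h], of "dw 1"]
      by (simp add: fun_eq_iff dw_dw_commute [of G' h] dw_dz_commute [of F' 1] D'_w)
    moreover have "wordfun (Suc p) q' (dw 1 F')" "wordfun p (Suc q') (dw 1 G')"
      using wordfun_dw_1 [OF F'] wordfun_dw_1 [OF G'] by (auto simp: q)
    ultimately obtain e2 where e2: "dw 1 G' = (\<lambda>z w. - S (int p) (int q) z w * e2)"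
      using divergence_free_wordfun q by blast
    have "D' z w = S (int p) (int q) z w * (e1 - e2)" for z w
      using fun_cong [OF fun_cong [OF eq' [of 1]], of z w] by (simp add: e1 e2 algebra_simps)
    then have "D = (\<lambda>z w. S (int p) (int q) z w * (c + (e1 - e2)))"
      by (simp add: D'_def fun_eq_iff algebra_simps)
    then show ?thesis by blast
  qed
qed

text \<open>The last equation is the form before \<open>S\<^bsub>p+1,q\<^esub>\<close> is split by its recursion. It expresses \<open>b\<close>
through \<open>F\<close> and \<open>a - b\<close>, which is used to bound the coefficients.\<close>

lemma wordfun_with_divergence:
  assumes F: "wordfun (Suc p) q F" and G: "wordfun p (Suc q) G"
    and eq: "\<And>h z w. dz h F z w + dw h G z w = h * D z w"
  obtains a b where
    "\<And>z w. F z w = z * (S (int p) (int q) z w * a) + w * (S (int p + 1) (int q - 1) z w * b)"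
    "\<And>z w. G z w = z * (- S (int p - 1) (int q + 1) z w * a) + w * (- S (int p) (int q) z w * b)"
    "\<And>z w. D z w = S (int p) (int q) z w * (a - b)"
    "\<And>z w. F z w = z * S (int p) (int q) z w * (a - b) + S (int p + 1) (int q) z w * b"
proof -
  obtain c where c: "D = (\<lambda>z w. S (int p) (int q) z w * c)"
    using divergence_wordfun [OF assms] by blast
  define F' where "F' = (\<lambda>z w. F z w - z * S (int p) (int q) z w * c)"
  define G' where "G' = (\<lambda>z w. G z w + z * S (int p - 1) (int q + 1) z w * c)"
  have F': "wordfun (Suc p) q F'"
    unfolding F'_def
    by (intro wordfun_diff wordfun_mult_right wordfun.mult_z wordfun_S F)
  have "wordfun p (Suc q) (\<lambda>z w. z * S (int p - 1) (int q + 1) z w)"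
  proof (cases p)
    case (Suc p')
    then show ?thesis using wordfun.mult_z [OF wordfun_S [of p' "Suc q"]] by (simp add: algebra_simps)
  qed (simp add: S_neg wordfun_zero)
  then have G': "wordfun p (Suc q) G'"
    unfolding G'_def by (intro wordfun.add wordfun_mult_right G)
  have "dz h F' z w + dw h G' z w = 0" for h z w
    using eq [of h z w] wordfun_polyfun [OF F] wordfun_polyfun [OF G]
    by (simp add: F'_def G'_def c dz_S_eq_dw_S algebra_simps)
  then obtain b where "F' = (\<lambda>z w. S (int (Suc p)) (int q) z w * b)"
    "G' = (\<lambda>z w. - S (int p) (int (Suc q)) z w * b)"
    using divergence_free_wordfun [OF F' G'] by blast
  then have F'_eq: "F' z w = S (int p + 1) (int q) z w * b"
    and G'_eq: "G' z w = - S (int p) (int q + 1) z w * b" for z w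
    by (simp_all add: add.commute)
  have *: "F z w = z * S (int p) (int q) z w * c + S (int p + 1) (int q) z w * b"
    "G z w = - (z * S (int p - 1) (int q + 1) z w * c) - S (int p) (int q + 1) z w * b" for z w
    using F'_eq [of z w] G'_eq [of z w] by (simp_all add: F'_def G'_def diff_eq_eq flip: eq_diff_eq)
  show thesis
  proof (rule that [of "b + c" b])
    fix z w
    show "F z w = z * (S (int p) (int q) z w * (b + c)) + w * (S (int p + 1) (int q - 1) z w * b)"
      using S_rec [of "int p + 1" "int q"] by (simp add: * algebra_simps)
    show "G z w = z * (- S (int p - 1) (int q + 1) z w * (b + c)) + w * (- S (int p) (int q) z w * b)"
      using S_rec [of "int p" "int q + 1"] by (simp add: * algebra_simps)
  qed (simp_all add: c *)
qed

section \<open>Coefficients of polynomials that decay pointwise\<close>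

lemma coeff_prod_linear_le:
  fixes x :: "'i \<Rightarrow> real"
  assumes "finite A" "\<And>i. i \<in> A \<Longrightarrow> \<bar>x i\<bar> \<le> 1"
  shows "\<bar>poly.coeff (\<Prod>i\<in>A. [:- x i, 1:]) k\<bar> \<le> 2 ^ card A"
  using assms
proof (induction A arbitrary: k rule: finite_induct)
  case empty
  then show ?case by (auto simp: one_pCons coeff_pCons split: nat.splits)
next
  case (insert a A)
  let ?P = "\<Prod>i\<in>A. [:- x i, 1:]"
  have IH: "\<bar>poly.coeff ?P k\<bar> \<le> 2 ^ card A" for k
    using insert by simp
  have shift: "\<bar>poly.coeff (pCons 0 ?P) k\<bar> \<le> 2 ^ card A"
    using IH by (auto simp: coeff_pCons split: nat.splits)
  have "\<bar>x a * poly.coeff ?P k\<bar> \<le> 1 * 2 ^ card A"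
    unfolding abs_mult using insert.prems IH by (intro mult_mono) auto
  with shift have "\<bar>- (x a * poly.coeff ?P k) + poly.coeff (pCons 0 ?P) k\<bar> \<le> 2 * 2 ^ card A"
    by linarith
  with insert.hyps show ?case by simp
qed

lemma prod_differences:
  fixes j d :: nat
  assumes "j \<le> d"
  shows "(\<Prod>i\<in>{..d} - {j}. \<bar>real j - real i\<bar>) = fact j * fact (d - j)"
proof -
  have split: "{..d} - {j} = {..<j} \<union> {j<..d}" using assms by auto
  have "(\<Prod>i\<in>{..d} - {j}. \<bar>real j - real i\<bar>)
      = (\<Prod>i<j. \<bar>real j - real i\<bar>) * (\<Prod>i\<in>{j<..d}. \<bar>real j - real i\<bar>)"
    unfolding split by (rule prod.union_disjoint) auto
  also have "(\<Prod>i<j. \<bar>real j - real i\<bar>) = (\<Prod>i\<in>{1..j}. real i)"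
    by (rule prod.reindex_bij_witness [of _ "\<lambda>i. j - i" "\<lambda>i. j - i"]) auto
  also have "\<dots> = fact j" by (simp add: fact_prod)
  also have "(\<Prod>i\<in>{j<..d}. \<bar>real j - real i\<bar>) = (\<Prod>i\<in>{1..d - j}. real i)"
    by (rule prod.reindex_bij_witness [of _ "\<lambda>i. i + j" "\<lambda>i. i - j"]) auto
  also have "\<dots> = fact (d - j)" by (simp add: fact_prod)
  finally show ?thesis .
qed

text \<open>The left-hand side divided by \<open>d!\<close> is a term of the series of \<open>exp (d+1)\<close>.\<close>

lemma power_le_fact: "real (Suc d) ^ d \<le> 3 ^ Suc d * fact d"
proof -
  have "(\<Sum>n\<in>{d}. real (Suc d) ^ n /\<^sub>R fact n) \<le> exp (real (Suc d))"
    unfolding exp_def by (intro sum_le_suminf summable_exp_generic) auto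
  also have "exp (real (Suc d)) = exp 1 ^ Suc d"
    by (simp only: exp_of_nat_mult [symmetric]) simp
  also have "\<dots> \<le> 3 ^ Suc d"
    using exp_le by (intro power_mono) auto
  finally show ?thesis by (simp add: field_simps)
qed

text \<open>Lagrange interpolation at the points \<open>x\<^sub>0, \<dots>, x\<^sub>d\<close>. For the \<open>j\<close>-th basis polynomial the gaps bound the
denominator below by \<open>\<delta>\<^sup>d j! (d-j)!\<close> with \<open>\<delta> = 1 / (4 (d+1))\<close>. Summing the reciprocals over
\<open>j\<close> gives \<open>2\<^sup>d / d!\<close>, and the factorial absorbs \<open>(d+1)\<^sup>d\<close> up to \<open>3\<^bsup>d+1\<^esup>\<close>; the remaining
powers \<open>2\<^sup>d 4\<^sup>d 2\<^sup>d 3\<^sup>d\<close> make up the constant \<open>48\<^sup>d\<close>.\<close>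

lemma coeff_le_of_values:
  fixes c :: "nat \<Rightarrow> 'v::real_normed_vector" and x :: "nat \<Rightarrow> real"
  assumes x01: "\<And>i. i \<le> d \<Longrightarrow> x i \<in> {0..1}"
    and gap: "\<And>i j. i < j \<Longrightarrow> j \<le> d \<Longrightarrow> x j - x i \<ge> (real j - real i) / (4 * (real d + 1))"
    and vals: "\<And>i. i \<le> d \<Longrightarrow> norm (\<Sum>k\<le>d. x i ^ k *\<^sub>R c k) \<le> M"
    and "k \<le> d"
  shows "norm (c k) \<le> 3 * 48 ^ d * M"
proof -
  have M: "M \<ge> 0" using vals [of 0] by (meson norm_ge_zero order_trans zero_le)
  define \<delta> where "\<delta> = 1 / (4 * (real d + 1))"
  have \<delta>: "\<delta> > 0" by (simp add: \<delta>_def)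
  have gap': "\<bar>x j - x i\<bar> \<ge> \<delta> * \<bar>real j - real i\<bar>" if "i \<le> d" "j \<le> d" for i j
    using gap [of i j] gap [of j i] that
    by (cases i j rule: linorder_cases) (auto simp: \<delta>_def)
  have distinct: "x j \<noteq> x i" if "i \<le> d" "j \<le> d" "i \<noteq> j" for i j
  proof -
    have "\<delta> * \<bar>real j - real i\<bar> > 0" using that \<delta> by simp
    with gap' [OF that(1,2)] show ?thesis by auto
  qed
  then have inj: "inj_on x {..d}" by (auto simp: inj_on_def)
  define L where "L = (\<lambda>j. smult (1 / (\<Prod>i\<in>{..d} - {j}. x j - x i)) (\<Prod>i\<in>{..d} - {j}. [:- x i, 1:]))"
  have poly_L: "poly (L j) (x i) = (if i = j then 1 else 0)" if "i \<le> d" "j \<le> d" for i j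
    using that distinct by (auto simp: L_def poly_prod intro!: prod_zero)
  have deg_L: "degree (L j) \<le> d" if "j \<le> d" for j
  proof -
    have "degree (L j) \<le> degree (\<Prod>i\<in>{..d} - {j}. [:- x i, 1:])"
      by (simp add: L_def degree_smult_le)
    also have "\<dots> \<le> (\<Sum>i\<in>{..d} - {j}. degree [:- x i, 1:])"
      using degree_prod_sum_le [of "{..d} - {j}" "\<lambda>i. [:- x i, 1:]"] by (simp add: o_def)
    also have "\<dots> = d" using that by simp
    finally show ?thesis .
  qed
  have interpolate: "(\<Sum>j\<le>d. x j ^ n * poly.coeff (L j) k) = (if n = k then 1 else 0)" if "n \<le> d" for n
  proof -
    define Q where "Q = (\<Sum>j\<le>d. smult (x j ^ n) (L j))"
    have "degree Q \<le> d"
      unfolding Q_def by (intro degree_sum_le) (auto intro: order_trans [OF degree_smult_le] deg_L)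
    have "Q = monom 1 n"
    proof (rule poly_eqI_degree [of "x ` {..d}"])
      fix y assume "y \<in> x ` {..d}"
      then obtain i where i: "i \<le> d" "y = x i" by auto
      have "poly Q y = (\<Sum>j\<le>d. if i = j then x j ^ n else 0)"
        unfolding Q_def poly_sum i(2) by (rule sum.cong) (auto simp: poly_L i(1))
      then show "poly Q y = poly (monom 1 n) y"
        using i by (simp add: poly_monom)
    qed (use \<open>degree Q \<le> d\<close> that inj in \<open>auto simp: card_image degree_monom_eq\<close>)
    then have "poly.coeff Q k = (if n = k then 1 else 0)" by simp
    then show ?thesis by (simp add: Q_def coeff_sum)
  qed
  have coeff_L: "\<bar>poly.coeff (L j) k\<bar> \<le> 2 ^ d * (4 * (real d + 1)) ^ d / (fact j * fact (d - j))"
    if "j \<le> d" for j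
  proof -
    have "\<delta> ^ d * (fact j * fact (d - j)) = (\<Prod>i\<in>{..d} - {j}. \<delta> * \<bar>real j - real i\<bar>)"
      using that by (simp add: prod.distrib prod_differences)
    also have "\<dots> \<le> (\<Prod>i\<in>{..d} - {j}. \<bar>x j - x i\<bar>)"
      using gap' that \<delta> by (intro prod_mono) auto
    finally have den: "\<delta> ^ d * (fact j * fact (d - j)) \<le> \<bar>\<Prod>i\<in>{..d} - {j}. x j - x i\<bar>"
      by (simp add: abs_prod)
    have num: "\<bar>poly.coeff (\<Prod>i\<in>{..d} - {j}. [:- x i, 1:]) k\<bar> \<le> 2 ^ d"
      using coeff_prod_linear_le [of "{..d} - {j}" x k] x01 that by force
    have "\<bar>poly.coeff (L j) k\<bar> \<le> 2 ^ d / (\<delta> ^ d * (fact j * fact (d - j)))"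
      unfolding L_def coeff_smult abs_mult abs_divide using num den \<delta>
      by (simp, intro frac_le) auto
    then show ?thesis by (simp add: \<delta>_def field_simps)
  qed
  have "(\<Sum>j\<le>d. poly.coeff (L j) k *\<^sub>R (\<Sum>n\<le>d. x j ^ n *\<^sub>R c n))
      = (\<Sum>n\<le>d. (\<Sum>j\<le>d. x j ^ n * poly.coeff (L j) k) *\<^sub>R c n)"
    unfolding scaleR_sum_right scaleR_sum_left
    by (subst sum.swap) (simp add: mult.commute)
  also have "\<dots> = (\<Sum>n\<le>d. if n = k then c n else 0)"
    by (intro sum.cong) (auto simp: interpolate)
  also have "\<dots> = c k" using \<open>k \<le> d\<close> by simp
  finally have "norm (c k) \<le> (\<Sum>j\<le>d. norm (poly.coeff (L j) k *\<^sub>R (\<Sum>n\<le>d. x j ^ n *\<^sub>R c n)))"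
    by (metis norm_sum)
  also have "\<dots> \<le> (\<Sum>j\<le>d. 2 ^ d * (4 * (real d + 1)) ^ d / (fact j * fact (d - j)) * M)"
    unfolding norm_scaleR using coeff_L vals M by (intro sum_mono mult_mono) auto
  also have "\<dots> = 2 ^ d * (4 * (real d + 1)) ^ d * M / fact d * (\<Sum>j\<le>d. real (d choose j))"
    unfolding sum_distrib_left by (intro sum.cong) (auto simp: binomial_fact)
  also have "(\<Sum>j\<le>d. real (d choose j)) = 2 ^ d"
    using choose_row_sum [of d] by (metis of_nat_sum of_nat_power of_nat_numeral)
  also have "2 ^ d * (4 * (real d + 1)) ^ d * M / fact d * 2 ^ d = 16 ^ d * M * (real (Suc d) ^ d / fact d)"
  proof -
    have "2 ^ d * (4 * (real d + 1)) ^ d * 2 ^ d = 16 ^ d * real (Suc d) ^ d"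
      unfolding power_mult_distrib [symmetric] by (rule arg_cong [of _ _ "\<lambda>x. x ^ d"]) simp
    then have "2 ^ d * (4 * (real d + 1)) ^ d * 2 ^ d * (M / fact d)
        = 16 ^ d * real (Suc d) ^ d * (M / fact d)" by (rule arg_cong)
    then show ?thesis by (simp only: mult_ac times_divide_eq_right times_divide_eq_left)
  qed
  also have "\<dots> \<le> 16 ^ d * M * 3 ^ Suc d"
    using M power_le_fact [of d] by (intro mult_left_mono) (simp_all add: field_simps)
  also have "\<dots> = 3 * 48 ^ d * M"
    by (simp flip: power_mult_distrib)
  finally show ?thesis .
qed

text \<open>Greedy choice: take a point of \<open>E\<close> within \<open>\<delta>\<close> of its infimum, discard everything within \<open>2 \<delta>\<close> of
the infimum, and continue with the rest, whose measure has dropped by at most \<open>2 \<delta>\<close>.\<close>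

lemma separated_points:
  fixes E :: "real set"
  assumes "E \<in> sets borel" "E \<subseteq> {0..1}" "\<delta> > 0" "measure lborel E > 2 * \<delta> * real d"
  shows "\<exists>x. (\<forall>i\<le>d. x i \<in> E) \<and> (\<forall>i<d. x (Suc i) - x i \<ge> \<delta>)"
  using assms(1,2,4)
proof (induction d arbitrary: E)
  case 0
  then have "E \<noteq> {}" by auto
  then show ?case by auto
next
  case (Suc d)
  have "measure lborel E > 0"
    using Suc.prems(3) \<open>\<delta> > 0\<close> by (rule_tac le_less_trans) auto
  then have "E \<noteq> {}" by auto
  have "bdd_below E" using Suc.prems(2) by (meson bdd_below_Icc bdd_below_mono)
  obtain x0 where x0: "x0 \<in> E" "x0 < Inf E + \<delta>"
    using cInf_lessD [OF \<open>E \<noteq> {}\<close>, of "Inf E + \<delta>"] \<open>\<delta> > 0\<close> by auto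
  define E' where "E' = E \<inter> {Inf E + 2 * \<delta>..}"
  have [measurable]: "E \<in> sets borel" by (rule Suc.prems)
  have E'_sets: "E' \<in> sets borel" by (simp add: E'_def)
  have fin: "E' \<in> fmeasurable lborel"
    by (rule fmeasurableI2 [of "{0..1}"]) (use Suc.prems in \<open>auto simp: E'_def fmeasurable_def\<close>)
  have "E \<subseteq> E' \<union> {Inf E..Inf E + 2 * \<delta>}"
    using cInf_lower [OF _ \<open>bdd_below E\<close>] by (auto simp: E'_def)
  then have "measure lborel E \<le> measure lborel (E' \<union> {Inf E..Inf E + 2 * \<delta>})"
    using fin by (intro measure_mono_fmeasurable fmeasurable.Un) (use \<open>\<delta> > 0\<close> in \<open>auto simp: fmeasurable_def\<close>)
  also have "\<dots> \<le> measure lborel E' + measure lborel {Inf E..Inf E + 2 * \<delta>}"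
    by (rule measure_Un_le) (auto simp: E'_def)
  also have "\<dots> = measure lborel E' + 2 * \<delta>" using \<open>\<delta> > 0\<close> by simp
  finally have "measure lborel E' > 2 * \<delta> * real d"
    using Suc.prems(3) by (simp add: algebra_simps)
  with Suc.IH [OF E'_sets] Suc.prems(2) obtain x where
    x: "\<forall>i\<le>d. x i \<in> E'" "\<forall>i<d. x (Suc i) - x i \<ge> \<delta>"
    by (auto simp: E'_def)
  have "x 0 - x0 \<ge> \<delta>" using x(1) x0 by (auto simp: E'_def)
  then have "case_nat x0 x (Suc i) - case_nat x0 x i \<ge> \<delta>" if "i < Suc d" for i
    using that x(2) by (cases i) auto
  moreover have "case_nat x0 x i \<in> E" if "i \<le> Suc d" for i
    using that x(1) x0(1) by (cases i) (auto simp: E'_def)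
  ultimately show ?case by blast
qed

text \<open>The sets \<open>E\<^sub>m\<close> of those \<open>s\<close> where \<open>m\<close> bounds the values for all \<open>d\<close> increase to \<open>[0,1]\<close>, so one of
them has measure more than \<open>1/2\<close> and contains \<open>d + 1\<close> points with gaps \<open>1 / (4 (d+1))\<close>, for every
\<open>d\<close>. The factor \<open>48\<^sup>d\<close> lost in passing to the coefficients is made up for by using the hypothesis
with \<open>48 R\<close> in place of \<open>R\<close>.

A Baire category argument would produce an interval in place of \<open>E\<^sub>m\<close>, but the base of the
exponential factor would then depend on its length, hence on \<open>R\<close>.\<close>

lemma coefficient_decay:
  fixes c :: "nat \<Rightarrow> nat \<Rightarrow> 'v::real_normed_vector"
  assumes bound: "\<And>s R. 0 \<le> s \<Longrightarrow> s \<le> 1 \<Longrightarrow> R > 0 \<Longrightarrow>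
      \<exists>M. \<forall>d. norm (\<Sum>k\<le>d. s ^ k *\<^sub>R c d k) * R ^ d \<le> M"
    and "R > 0"
  shows "\<exists>M. \<forall>d. \<forall>k\<le>d. norm (c d k) * R ^ d \<le> M"
proof -
  define g where "g = (\<lambda>d s. norm (\<Sum>k\<le>d. s ^ k *\<^sub>R c d k) * (48 * R) ^ d)"
  define E where "E = (\<lambda>m::nat. {s\<in>{0..1}. \<forall>d. g d s \<le> real m})"
  have E_eq: "E m = {0..1} \<inter> (\<Inter>d. {s. g d s \<le> real m})" for m
    by (auto simp: E_def)
  have "closed (E m)" for m
    unfolding E_eq g_def by (intro closed_Int closed_INT ballI closed_Collect_le continuous_intros)
  then have E_sets: "E m \<in> sets borel" for m by (rule borel_closed)
  have "incseq E"
  proof (rule incseq_SucI, rule subsetI)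
    fix m s assume "s \<in> E m"
    then have "g d s \<le> real (Suc m)" for d
      using order_trans [of "g d s" "real m" "real (Suc m)"] by (simp add: E_def)
    with \<open>s \<in> E m\<close> show "s \<in> E (Suc m)" by (simp add: E_def)
  qed
  have "(\<Union>m. E m) = {0..1}"
  proof (intro equalityI subsetI)
    fix s :: real assume s: "s \<in> {0..1}"
    with bound [of s "48 * R"] \<open>R > 0\<close> obtain M where M: "\<And>d. g d s \<le> M"
      by (auto simp: g_def)
    obtain m :: nat where "M \<le> real m" using real_arch_simple by blast
    with M s have "s \<in> E m" by (auto simp: E_def intro: order_trans)
    then show "s \<in> (\<Union>m. E m)" by blast
  qed (auto simp: E_def)
  then have "(\<lambda>m. measure lborel (E m)) \<longlonglongrightarrow> measure lborel {0..1::real}"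
    using Lim_measure_incseq [of E lborel] E_sets \<open>incseq E\<close> by auto
  then have "\<forall>\<^sub>F m in sequentially. measure lborel (E m) > 1 / 2"
    by (rule order_tendstoD) simp
  then obtain m where m: "measure lborel (E m) > 1 / 2"
    by (auto simp: eventually_sequentially)
  show ?thesis
  proof (intro exI [of _ "3 * real m"] allI impI)
    fix d k :: nat assume "k \<le> d"
    define \<delta> where "\<delta> = 1 / (4 * (real d + 1))"
    have "\<delta> > 0" by (simp add: \<delta>_def)
    have "2 * \<delta> * real d \<le> 1 / 2" by (simp add: \<delta>_def field_simps)
    with m have "measure lborel (E m) > 2 * \<delta> * real d" by linarith
    with separated_points [OF E_sets _ \<open>\<delta> > 0\<close>] obtain x where
      x: "\<And>i. i \<le> d \<Longrightarrow> x i \<in> E m" "\<And>i. i < d \<Longrightarrow> x (Suc i) - x i \<ge> \<delta>"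
      by (force simp: E_def)
    have gap: "x j - x i \<ge> (real j - real i) / (4 * (real d + 1))" if "i < j" "j \<le> d" for i j
      using that
    proof (induction j)
      case (Suc j)
      have "x j - x i \<ge> (real j - real i) / (4 * (real d + 1))"
        using Suc by (cases "i = j") auto
      with x(2) [of j] Suc.prems show ?case by (simp add: \<delta>_def add_divide_distrib diff_divide_distrib)
    qed simp
    have "norm (c d k) \<le> 3 * 48 ^ d * (real m / (48 * R) ^ d)"
    proof (rule coeff_le_of_values [of d x "c d", OF _ gap _ \<open>k \<le> d\<close>])
      fix i assume "i \<le> d"
      from x(1) [OF this] show "x i \<in> {0..1}" by (simp add: E_def)
      from x(1) [OF \<open>i \<le> d\<close>] \<open>R > 0\<close> show "norm (\<Sum>k\<le>d. x i ^ k *\<^sub>R c d k) \<le> real m / (48 * R) ^ d"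
        by (simp add: E_def g_def pos_le_divide_eq)
    qed auto
    then show "norm (c d k) * R ^ d \<le> 3 * real m"
      using \<open>R > 0\<close> by (simp add: power_mult_distrib field_simps)
  qed
qed

section \<open>Power series and double series\<close>

lemma power_series_zero:
  fixes c :: "nat \<Rightarrow> 'v::real_inner"
  assumes "\<And>r. r \<noteq> 0 \<Longrightarrow> (\<lambda>n. r ^ n *\<^sub>R c n) sums 0"
  shows "c n = 0"
proof -
  have "c n \<bullet> v = 0" for v
  proof (induction n rule: less_induct)
    case (less n)
    have "(\<lambda>k. (c (k + n) \<bullet> v) * r ^ k) sums 0" if "r \<noteq> 0" for r
    proof -
      have "(\<lambda>k. (r ^ k *\<^sub>R c k) \<bullet> v) sums (0 \<bullet> v)"
        using assms [OF that] by (rule bounded_linear.sums [OF bounded_linear_inner_left])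
      then have "(\<lambda>k. (c k \<bullet> v) * r ^ k) sums 0"
        by (simp add: mult.commute)
      then have "(\<lambda>k. (c (k + n) \<bullet> v) * r ^ (k + n)) sums 0"
        using sums_iff_shift [of "\<lambda>k. (c k \<bullet> v) * r ^ k" n 0] less.IH by simp
      then have "(\<lambda>k. inverse (r ^ n) * ((c (k + n) \<bullet> v) * r ^ (k + n))) sums (inverse (r ^ n) * 0)"
        by (rule sums_mult)
      then show ?thesis using that by (simp add: power_add field_simps)
    qed
    then have "((\<lambda>r::real. 0) \<longlongrightarrow> c (0 + n) \<bullet> v) (at 0)"
      by (intro powser_limit_0_strong [of 1 "\<lambda>k. c (k + n) \<bullet> v"]) auto
    then show "c n \<bullet> v = 0" by (simp add: tendsto_const_iff)
  qed
  then show ?thesis using inner_eq_zero_iff by blast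
qed

text \<open>Regrouping the terms of a double series by total degree.\<close>

lemma has_sum_diagonals:
  fixes f :: "nat \<times> nat \<Rightarrow> 'v::banach"
  assumes "(f has_sum x) UNIV"
  shows "(\<lambda>d. \<Sum>p\<le>d. f (p, d - p)) sums x"
proof -
  have "((\<lambda>(d, p). f (p, d - p)) has_sum x) (SIGMA d:UNIV. {..d})"
    using assms
    by (subst has_sum_reindex_bij_witness [where T = UNIV and h = f and s' = x
          and i = "\<lambda>(p, q). (p + q, p)" and j = "\<lambda>(d, p). (p, d - p)"]) auto
  then have "((\<lambda>d. \<Sum>p\<le>d. f (p, d - p)) has_sum x) UNIV"
    by (rule has_sum_SigmaD) (simp add: has_sum_finite)
  then show ?thesis by (rule has_sum_imp_sums)
qed

lemma summable_half_powers: "(\<lambda>(p, q). (1 / 2) ^ (p + q) :: real) summable_on (UNIV :: (nat \<times> nat) set)"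
proof -
  have half: "((\<lambda>q. (1 / 2) ^ q :: real) has_sum 2) UNIV"
    using geometric_sums [of "1 / 2 :: real"] by (intro sums_nonneg_imp_has_sum) auto
  have "(\<lambda>(p, q). (1 / 2) ^ (p + q) :: real) summable_on Sigma (UNIV::nat set) (\<lambda>_. UNIV::nat set)"
  proof (rule summable_on_SigmaI)
    fix p :: nat
    have "((\<lambda>q. (1 / 2) ^ (p + q) :: real) has_sum (1 / 2) ^ p * 2) UNIV"
      using has_sum_cmult_right [OF half, of "(1 / 2) ^ p"] by (simp add: power_add)
    then show "((\<lambda>q. (\<lambda>(p, q). (1 / 2) ^ (p + q) :: real) (p, q)) has_sum (1 / 2) ^ p * 2) UNIV"
      by simp
    show "(\<lambda>p. (1 / 2) ^ p * 2 :: real) summable_on UNIV"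
      using has_sum_imp_summable [OF half] by (rule summable_on_cmult_left)
  qed auto
  then show ?thesis by simp
qed

lemma summable_on_half_powers:
  fixes u :: "nat \<times> nat \<Rightarrow> 'v::banach"
  assumes "\<And>p q. norm (u (p, q)) \<le> M * (1 / 2) ^ (p + q)"
  shows "u summable_on UNIV"
proof (rule abs_summable_summable, rule Infinite_Sum.abs_summable_on_comparison_test')
  show "(\<lambda>x. M * (case x of (p, q) \<Rightarrow> (1 / 2) ^ (p + q))) summable_on UNIV"
    by (rule summable_on_cmult_right [OF summable_half_powers])
qed (use assms in auto)

section \<open>Bihomogeneous parts of an entire series\<close>

definition bihom :: "(bool list \<Rightarrow> quat) \<Rightarrow> nat \<Rightarrow> nat \<Rightarrow> quat \<Rightarrow> quat \<Rightarrow> quat" where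
  "bihom A p q z w = (\<Sum>\<alpha>\<in>words (int p) (int q). word z w \<alpha> * A \<alpha>)"

lemma wordfun_word: "wordfun (weight \<alpha>) (length \<alpha> - weight \<alpha>) (\<lambda>z w. word z w \<alpha> * c)"
proof (induction \<alpha>)
  case Nil
  show ?case by (simp add: word_def weight_def wordfun.const)
next
  case (Cons x \<alpha>)
  have "Suc (length \<alpha>) - weight \<alpha> = Suc (length \<alpha> - weight \<alpha>)"
    using weight_le [of \<alpha>] by simp
  with wordfun.mult_z [OF Cons] wordfun.mult_w [OF Cons] show ?case
    by (cases x) (simp_all add: weight_def word_def mult.assoc)
qed

lemma wordfun_bihom: "wordfun p q (bihom A p q)"
  unfolding bihom_def
proof (rule wordfun_sum)
  fix \<alpha> assume "\<alpha> \<in> words (int p) (int q)"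
  then have "weight \<alpha> = p" "length \<alpha> - weight \<alpha> = q"
    by (auto simp: words_def)
  then show "wordfun p q (\<lambda>z w. word z w \<alpha> * A \<alpha>)"
    using wordfun_word [of \<alpha>] by simp
qed simp

lemma polyfun_bihom [simp]: "polyfun (bihom A p q)"
  by (rule wordfun_polyfun [OF wordfun_bihom])

lemma hom_part_eq_sum_bihom: "hom_part A d z w = (\<Sum>p\<le>d. bihom A p (d - p) z w)"
proof -
  have fin: "finite {\<alpha>::bool list. length \<alpha> = d}"
    using finite_lists_length_eq [of "UNIV :: bool set" d] by simp
  have *: "{\<alpha> \<in> {\<alpha>. length \<alpha> = d}. weight \<alpha> = p} = words (int p) (int (d - p))" if "p \<le> d" for p
    using that by (auto simp: words_def)
  have "hom_part A d z w = (\<Sum>p\<le>d. \<Sum>\<alpha>\<in>{\<alpha> \<in> {\<alpha>. length \<alpha> = d}. weight \<alpha> = p}. word z w \<alpha> * A \<alpha>)"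
    unfolding hom_part_def using weight_le by (intro sum.group [symmetric] fin) auto
  also have "\<dots> = (\<Sum>p\<le>d. bihom A p (d - p) z w)"
    by (rule sum.cong) (auto simp only: * bihom_def atMost_iff)
  finally show ?thesis .
qed

lemma hom_part_scale: "hom_part A d (r *\<^sub>R z) (r *\<^sub>R w) = r ^ d *\<^sub>R hom_part A d z w"
  unfolding hom_part_eq_sum_bihom scaleR_sum_right
  by (intro sum.cong refl) (simp add: wordfun_scale [OF wordfun_bihom] flip: power_add)

lemma linear_times_polynomial:
  fixes \<phi> :: "nat \<Rightarrow> 'v::real_algebra_1"
  shows "\<exists>\<psi>. \<forall>s::real. (x + s *\<^sub>R y) * (\<Sum>i\<le>n. s ^ i *\<^sub>R \<phi> i) = (\<Sum>i\<le>Suc n. s ^ i *\<^sub>R \<psi> i)"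
proof (intro exI allI)
  fix s :: real
  let ?\<psi> = "\<lambda>i. (if i \<le> n then x * \<phi> i else 0) + (case i of 0 \<Rightarrow> 0 | Suc j \<Rightarrow> y * \<phi> j)"
  have "(\<Sum>i\<le>Suc n. s ^ i *\<^sub>R ?\<psi> i)
      = (\<Sum>i\<le>Suc n. s ^ i *\<^sub>R (if i \<le> n then x * \<phi> i else 0))
      + (\<Sum>i\<le>Suc n. s ^ i *\<^sub>R (case i of 0 \<Rightarrow> 0 | Suc j \<Rightarrow> y * \<phi> j))"
    by (simp only: scaleR_add_right sum.distrib)
  also have "(\<Sum>i\<le>Suc n. s ^ i *\<^sub>R (if i \<le> n then x * \<phi> i else 0)) = x * (\<Sum>i\<le>n. s ^ i *\<^sub>R \<phi> i)"
    by (simp add: sum_distrib_left)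
  also have "(\<Sum>i\<le>Suc n. s ^ i *\<^sub>R (case i of 0 \<Rightarrow> 0 | Suc j \<Rightarrow> y * \<phi> j))
      = s *\<^sub>R y * (\<Sum>i\<le>n. s ^ i *\<^sub>R \<phi> i)"
    by (subst sum.atMost_Suc_shift) (simp add: sum_distrib_left scaleR_sum_right mult.commute)
  finally show "(x + s *\<^sub>R y) * (\<Sum>i\<le>n. s ^ i *\<^sub>R \<phi> i) = (\<Sum>i\<le>Suc n. s ^ i *\<^sub>R ?\<psi> i)"
    by (simp only: distrib_right)
qed

lemma wordfun_line:
  "wordfun p q f \<Longrightarrow> \<exists>\<phi>. \<forall>s. f (z + s *\<^sub>R h) (w + s *\<^sub>R k) = (\<Sum>i\<le>p + q. s ^ i *\<^sub>R \<phi> i)"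
proof (induction rule: wordfun.induct)
  case (const c)
  show ?case by (auto intro: exI [of _ "\<lambda>_. c"])
next
  case (mult_z p q f)
  then obtain \<phi> where \<phi>: "\<And>s. f (z + s *\<^sub>R h) (w + s *\<^sub>R k) = (\<Sum>i\<le>p + q. s ^ i *\<^sub>R \<phi> i)" by blast
  show ?case
    unfolding \<phi> add_Suc by (rule linear_times_polynomial)
next
  case (mult_w p q f)
  then obtain \<phi> where \<phi>: "\<And>s. f (z + s *\<^sub>R h) (w + s *\<^sub>R k) = (\<Sum>i\<le>p + q. s ^ i *\<^sub>R \<phi> i)" by blast
  show ?case
    unfolding \<phi> add_Suc_right by (rule linear_times_polynomial)
next
  case (add p q f g)
  then obtain \<phi> \<psi> where
    "\<And>s. f (z + s *\<^sub>R h) (w + s *\<^sub>R k) = (\<Sum>i\<le>p + q. s ^ i *\<^sub>R \<phi> i)"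
    "\<And>s. g (z + s *\<^sub>R h) (w + s *\<^sub>R k) = (\<Sum>i\<le>p + q. s ^ i *\<^sub>R \<psi> i)" by blast
  then show ?case
    by (intro exI [of _ "\<lambda>i. \<phi> i + \<psi> i"]) (simp add: scaleR_add_right sum.distrib)
qed

lemma hom_part_line:
  "\<exists>\<phi>. \<forall>s. hom_part A d (z + s *\<^sub>R h) (w + s *\<^sub>R k) = (\<Sum>i\<le>d. s ^ i *\<^sub>R \<phi> i)"
proof -
  have "\<exists>\<phi>. \<forall>s. bihom A p (d - p) (z + s *\<^sub>R h) (w + s *\<^sub>R k) = (\<Sum>i\<le>d. s ^ i *\<^sub>R \<phi> i)" if "p \<le> d" for p
    using wordfun_line [OF wordfun_bihom [of p "d - p" A], of z h w k] that by simp
  then obtain \<phi> where "\<And>p s. p \<le> d \<Longrightarrow>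
      bihom A p (d - p) (z + s *\<^sub>R h) (w + s *\<^sub>R k) = (\<Sum>i\<le>d. s ^ i *\<^sub>R \<phi> p i)"
    by metis
  then have "hom_part A d (z + s *\<^sub>R h) (w + s *\<^sub>R k) = (\<Sum>i\<le>d. s ^ i *\<^sub>R (\<Sum>p\<le>d. \<phi> p i))" for s
    unfolding hom_part_eq_sum_bihom scaleR_sum_right by (subst sum.swap) simp
  then show ?thesis by (intro exI allI)
qed

text \<open>Convergence on the whole of the space is used through scaling: it turns boundedness of the
homogeneous parts at \<open>(R z, R w)\<close> into decay like \<open>R\<^bsup>-d\<^esup>\<close> at \<open>(z, w)\<close>, for every \<open>R\<close>.\<close>

locale entire_series =
  fixes A :: "bool list \<Rightarrow> quat"
  assumes summable: "\<And>z w. summable (\<lambda>d. norm (hom_part A d z w))"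
begin

lemma hom_part_bound: "\<exists>M. \<forall>d. norm (hom_part A d z w) * R ^ d \<le> M" if "R > 0"
proof -
  have "norm (hom_part A d z w) * R ^ d = norm (hom_part A d (R *\<^sub>R z) (R *\<^sub>R w))" for d
    using that by (simp add: hom_part_scale mult.commute)
  moreover obtain M where "\<And>d. norm (norm (hom_part A d (R *\<^sub>R z) (R *\<^sub>R w))) \<le> M"
    using summable_imp_Bseq [OF summable] unfolding Bseq_def by blast
  ultimately show ?thesis by auto
qed

lemma bihom_bound:
  assumes "R > 0"
  shows "\<exists>M. \<forall>p q. norm (bihom A p q z w) * R ^ (p + q) \<le> M"
proof -
  have "\<exists>M. \<forall>d. \<forall>p\<le>d. norm (bihom A p (d - p) z w) * R ^ d \<le> M"
  proof (rule coefficient_decay [OF _ assms])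
    fix s R :: real assume "R > 0"
    have "(\<Sum>p\<le>d. s ^ p *\<^sub>R bihom A p (d - p) z w) = hom_part A d (s *\<^sub>R z) w" for d
      unfolding hom_part_eq_sum_bihom
      using wordfun_scale [OF wordfun_bihom, where t = 1] by simp
    with hom_part_bound [OF \<open>R > 0\<close>]
    show "\<exists>M. \<forall>d. norm (\<Sum>p\<le>d. s ^ p *\<^sub>R bihom A p (d - p) z w) * R ^ d \<le> M"
      by simp
  qed
  then obtain M where M: "\<And>d p. p \<le> d \<Longrightarrow> norm (bihom A p (d - p) z w) * R ^ d \<le> M" by blast
  have "norm (bihom A p q z w) * R ^ (p + q) \<le> M" for p q
    using M [of p "p + q"] by simp
  then show ?thesis by blast
qed

end

lemma has_vector_derivative_polynomial_0:
  "((\<lambda>s. \<Sum>i\<le>n. s ^ i *\<^sub>R c i) has_vector_derivative (if n = 0 then 0 else c 1)) (at 0)"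
proof (induction n)
  case (Suc n)
  have "((\<lambda>s. s ^ Suc n *\<^sub>R c (Suc n)) has_vector_derivative (real (Suc n) * 0 ^ n) *\<^sub>R c (Suc n)) (at 0)"
    by (auto intro!: derivative_eq_intros simp del: power_Suc)
  from has_vector_derivative_add [OF Suc this] show ?case
    by (cases n) (simp_all add: add.commute)
qed simp

text \<open>For \<open>\<bar>t\<bar> \<le> 1\<close> the \<open>d\<close>-th difference quotient differs from the linear coefficient by the terms with \<open>i \<ge> 2\<close>, of
norm at most \<open>\<bar>t\<bar> d M / 4\<^sup>d \<le> \<bar>t\<bar> M / 2\<^sup>d\<close>, which is summable over \<open>d\<close> and tends to zero with \<open>t\<close>.\<close>

lemma termwise_derivative:
  fixes c :: "nat \<Rightarrow> nat \<Rightarrow> 'v::banach"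
  assumes bound: "\<And>d i. i \<le> d \<Longrightarrow> norm (c d i) * 4 ^ d \<le> M"
    and sums: "\<And>s. (\<lambda>d. \<Sum>i\<le>d. s ^ i *\<^sub>R c d i) sums G s"
    and lim: "((\<lambda>t. (1 / t) *\<^sub>R (G t - G 0)) \<longlongrightarrow> l) (at 0)"
  shows "(\<lambda>d. if d = 0 then 0 else c d 1) sums l"
proof -
  define c1 where "c1 = (\<lambda>d. if d = 0 then 0 else c d 1)"
  have M: "M \<ge> 0" using bound [of 0 0] by (simp add: order_trans [OF norm_ge_zero])
  have half: "(\<lambda>d. (1 / 2) ^ d :: real) sums 2"
    using geometric_sums [of "1 / 2 :: real"] by simp
  have c_le: "norm (c d i) \<le> M / 4 ^ d" if "i \<le> d" for d i
    using bound [OF that] by (simp add: pos_le_divide_eq)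
  have "norm (c1 d) \<le> M * (1 / 2) ^ d" for d
  proof -
    have "norm (c1 d) \<le> M / 4 ^ d" using c_le [of 1 d] M by (auto simp: c1_def)
    also have "\<dots> \<le> M / 2 ^ d" using M by (intro divide_left_mono power_mono) auto
    finally show ?thesis by (simp add: power_one_over)
  qed
  then have "summable c1"
    by (intro summable_comparison_test' [OF sums_summable [OF sums_mult [OF half]]]) auto
  have rest: "norm ((1 / t) *\<^sub>R (G t - G 0) - suminf c1) \<le> \<bar>t\<bar> * (M * 2)" if "t \<noteq> 0" "\<bar>t\<bar> \<le> 1" for t
  proof -
    define u where "u = (\<lambda>d. (1 / t) *\<^sub>R ((\<Sum>i\<le>d. t ^ i *\<^sub>R c d i) - (\<Sum>i\<le>d. 0 ^ i *\<^sub>R c d i)) - c1 d)"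
    have u_sums: "u sums ((1 / t) *\<^sub>R (G t - G 0) - suminf c1)"
      unfolding u_def by (intro sums_diff sums_scaleR_right sums summable_sums \<open>summable c1\<close>)
    have u_le: "norm (u d) \<le> \<bar>t\<bar> * (M * (1 / 2) ^ d)" for d
    proof -
      have "u d = (\<Sum>i\<in>{2..d}. t ^ (i - 1) *\<^sub>R c d i)"
      proof (cases "d = 0")
        case False
        have "{..d} = {0, 1} \<union> {2..d}" using False by auto
        then have split: "(\<Sum>i\<le>d. x i) = x 0 + x 1 + (\<Sum>i\<in>{2..d}. x i)" for x :: "nat \<Rightarrow> 'v"
          by (simp add: sum.union_disjoint)
        have "(\<Sum>i\<in>{2..d}. 0 ^ i *\<^sub>R c d i) = 0" by (intro sum.neutral) auto
        moreover have "(1 / t) *\<^sub>R (\<Sum>i\<in>{2..d}. t ^ i *\<^sub>R c d i) = (\<Sum>i\<in>{2..d}. t ^ (i - 1) *\<^sub>R c d i)"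
          unfolding scaleR_sum_right
        proof (rule sum.cong)
          fix i assume "i \<in> {2..d}"
          then obtain j where "i = Suc j" by (cases i) auto
          with \<open>t \<noteq> 0\<close> show "(1 / t) *\<^sub>R t ^ i *\<^sub>R c d i = t ^ (i - 1) *\<^sub>R c d i" by simp
        qed simp
        ultimately show ?thesis
          using False \<open>t \<noteq> 0\<close> by (simp add: u_def c1_def split scaleR_add_right)
      qed (simp add: u_def c1_def)
      then have "norm (u d) \<le> (\<Sum>i\<in>{2..d}. norm (t ^ (i - 1) *\<^sub>R c d i))"
        by (simp only: norm_sum)
      also have "\<dots> \<le> (\<Sum>i\<in>{2..d}. \<bar>t\<bar> * (M / 4 ^ d))"
      proof (rule sum_mono)
        fix i assume i: "i \<in> {2..d}"
        then have "\<bar>t\<bar> ^ (i - 1) \<le> \<bar>t\<bar> ^ 1"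
          using that by (intro power_decreasing) auto
        with c_le [of i d] i show "norm (t ^ (i - 1) *\<^sub>R c d i) \<le> \<bar>t\<bar> * (M / 4 ^ d)"
          unfolding norm_scaleR by (intro mult_mono) (auto simp: power_abs)
      qed
      also have "\<dots> = real (d - 1) * (\<bar>t\<bar> * (M / 4 ^ d))" by simp
      also have "\<dots> \<le> 2 ^ d * (\<bar>t\<bar> * (M / 4 ^ d))"
      proof (intro mult_right_mono)
        have "d - 1 < 2 ^ d" using less_exp [of d] by linarith
        then show "real (d - 1) \<le> 2 ^ d" by (metis less_imp_le of_nat_less_iff of_nat_numeral of_nat_power)
      qed (use M in auto)
      also have "\<dots> = \<bar>t\<bar> * (M * (1 / 2) ^ d)"
      proof -
        have "(4::real) ^ d = 2 ^ d * 2 ^ d" by (simp flip: power_mult_distrib)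
        then show ?thesis by (simp add: power_one_over field_simps)
      qed
      finally show ?thesis .
    qed
    have bnd: "(\<lambda>d. \<bar>t\<bar> * (M * (1 / 2) ^ d)) sums (\<bar>t\<bar> * (M * 2))"
      by (intro sums_mult half)
    have "norm (suminf u) \<le> (\<Sum>d. \<bar>t\<bar> * (M * (1 / 2) ^ d))"
      using u_le by (rule norm_suminf_le [OF _ sums_summable [OF bnd]])
    then show ?thesis using sums_unique [OF u_sums] sums_unique [OF bnd] by simp
  qed
  have "((\<lambda>t. (1 / t) *\<^sub>R (G t - G 0) - suminf c1) \<longlongrightarrow> 0) (at 0)"
  proof (rule Lim_null_comparison)
    show "\<forall>\<^sub>F t in at 0. norm ((1 / t) *\<^sub>R (G t - G 0) - suminf c1) \<le> \<bar>t\<bar> * (M * 2)"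
      unfolding eventually_at by (rule exI [of _ 1]) (auto intro!: rest)
    show "((\<lambda>t. \<bar>t\<bar> * (M * 2)) \<longlongrightarrow> 0) (at 0)"
      by (rule tendsto_eq_intros refl)+ simp
  qed
  then have "((\<lambda>t. (1 / t) *\<^sub>R (G t - G 0)) \<longlongrightarrow> suminf c1) (at 0)"
    by (simp add: LIM_zero_iff)
  with lim have "l = suminf c1" by (rule tendsto_unique [rotated]) simp
  with summable_sums [OF \<open>summable c1\<close>] show ?thesis by (simp add: c1_def)
qed

lemma (in entire_series) hom_part_derivative_sums:
  assumes lim: "((\<lambda>t. (1 / t) *\<^sub>R ((\<Sum>d. hom_part A d (z + t *\<^sub>R h) (w + t *\<^sub>R k))
      - (\<Sum>d. hom_part A d z w))) \<longlongrightarrow> l) (at 0)"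
    and deriv: "\<And>d. ((\<lambda>t. hom_part A d (z + t *\<^sub>R h) (w + t *\<^sub>R k)) has_vector_derivative D d) (at 0)"
  shows "D sums l"
proof -
  obtain \<phi> where \<phi>: "\<And>d s. hom_part A d (z + s *\<^sub>R h) (w + s *\<^sub>R k) = (\<Sum>i\<le>d. s ^ i *\<^sub>R \<phi> d i)"
    using hom_part_line [of A _ z h w k] by metis
  have "\<exists>M. \<forall>d. \<forall>i\<le>d. norm (\<phi> d i) * 4 ^ d \<le> M"
  proof (rule coefficient_decay)
    fix s R :: real assume "R > 0"
    with hom_part_bound [OF this, of "z + s *\<^sub>R h" "w + s *\<^sub>R k"]
    show "\<exists>M. \<forall>d. norm (\<Sum>i\<le>d. s ^ i *\<^sub>R \<phi> d i) * R ^ d \<le> M" by (simp add: \<phi>)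
  qed simp
  then obtain M where "\<And>d i. i \<le> d \<Longrightarrow> norm (\<phi> d i) * 4 ^ d \<le> M" by blast
  then have "(\<lambda>d. if d = 0 then 0 else \<phi> d 1) sums l"
  proof (rule termwise_derivative)
    show "(\<lambda>d. \<Sum>i\<le>d. s ^ i *\<^sub>R \<phi> d i) sums (\<Sum>d. hom_part A d (z + s *\<^sub>R h) (w + s *\<^sub>R k))" for s
      unfolding \<phi> [symmetric] by (intro summable_sums summable_norm_cancel [OF summable])
    next
    show "((\<lambda>t. (1 / t) *\<^sub>R ((\<Sum>d. hom_part A d (z + t *\<^sub>R h) (w + t *\<^sub>R k))
        - (\<Sum>d. hom_part A d (z + 0 *\<^sub>R h) (w + 0 *\<^sub>R k)))) \<longlongrightarrow> l) (at 0)"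
      unfolding scaleR_zero_left add_0_right by (rule lim)
  qed
  moreover have "D = (\<lambda>d. if d = 0 then 0 else \<phi> d 1)"
  proof
    fix d
    show "D d = (if d = 0 then 0 else \<phi> d 1)"
      using deriv [of d] has_vector_derivative_polynomial_0 [of "\<phi> d" d]
      unfolding \<phi> by (rule vector_derivative_unique_at)
  qed
  ultimately show ?thesis by simp
qed

section \<open>Bihomogeneous parts of a vector field with divergence\<close>

lemma polyfun_sum: "finite I \<Longrightarrow> (\<And>i. i \<in> I \<Longrightarrow> polyfun (f i)) \<Longrightarrow> polyfun (\<lambda>z w. \<Sum>i\<in>I. f i z w)"
  by (induction rule: finite_induct) auto

lemma dz_sum: "finite I \<Longrightarrow> (\<And>i. i \<in> I \<Longrightarrow> polyfun (f i)) \<Longrightarrow>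
    dz h (\<lambda>z w. \<Sum>i\<in>I. f i z w) = (\<lambda>z w. \<Sum>i\<in>I. dz h (f i) z w)"
  by (induction rule: finite_induct) (auto simp: polyfun_sum)

lemma dw_sum: "finite I \<Longrightarrow> (\<And>i. i \<in> I \<Longrightarrow> polyfun (f i)) \<Longrightarrow>
    dw h (\<lambda>z w. \<Sum>i\<in>I. f i z w) = (\<lambda>z w. \<Sum>i\<in>I. dw h (f i) z w)"
  by (induction rule: finite_induct) (auto simp: polyfun_sum)

lemma hom_part_fun: "hom_part A d = (\<lambda>z w. \<Sum>p\<le>d. bihom A p (d - p) z w)"
  by (intro ext) (rule hom_part_eq_sum_bihom)

lemma polyfun_hom_part [simp]: "polyfun (hom_part A d)"
  unfolding hom_part_fun by (rule polyfun_sum) auto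

text \<open>The component \<open>p = 0\<close> contains no \<open>z\<close>. Shifting the degree by one here, and likewise for \<open>w\<close>,
aligns the parts of \<open>f\<close> and \<open>g\<close> that contribute to the same bidegree of the divergence.\<close>

lemma dz_hom_part:
  "dz h (hom_part A 0) z w = 0"
  "dz h (hom_part A (Suc d)) z w = (\<Sum>p\<le>d. dz h (bihom A (Suc p) (d - p)) z w)"
proof -
  have [simp]: "dz h (bihom A 0 q) z w = 0" for q
    using wordfun_dz_0 [OF wordfun_bihom] by simp
  show "dz h (hom_part A 0) z w = 0"
    unfolding hom_part_fun by (subst dz_sum) auto
  show "dz h (hom_part A (Suc d)) z w = (\<Sum>p\<le>d. dz h (bihom A (Suc p) (d - p)) z w)"
    unfolding hom_part_fun by (subst dz_sum, simp, simp, subst sum.atMost_Suc_shift) simp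
qed

lemma dw_hom_part:
  "dw h (hom_part A 0) z w = 0"
  "dw h (hom_part A (Suc d)) z w = (\<Sum>p\<le>d. dw h (bihom A p (Suc (d - p))) z w)"
proof -
  have [simp]: "dw h (bihom A p 0) z w = 0" for p
    using wordfun_dw_0 [OF wordfun_bihom] by simp
  show "dw h (hom_part A 0) z w = 0"
    unfolding hom_part_fun by (subst dw_sum) auto
  show "dw h (hom_part A (Suc d)) z w = (\<Sum>p\<le>d. dw h (bihom A p (Suc (d - p))) z w)"
    unfolding hom_part_fun by (subst dw_sum) (simp_all add: Suc_diff_le)
qed

lemma hom_part_0_left:
  "hom_part A 0 z w = hom_part A 0 0 w"
  "hom_part A (Suc d) z w - hom_part A (Suc d) 0 w = (\<Sum>p\<le>d. bihom A (Suc p) (d - p) z w)"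
proof -
  have no_z: "bihom A 0 q z w = bihom A 0 q 0 w" for q
    using wordfun_z_0 [OF wordfun_bihom] by metis
  have z: "bihom A (Suc p) q 0 w = 0" for p q
    using wordfun_scale [OF wordfun_bihom, of A "Suc p" q 0 0 1 w] by simp
  show "hom_part A 0 z w = hom_part A 0 0 w"
    by (simp add: hom_part_eq_sum_bihom no_z)
  show "hom_part A (Suc d) z w - hom_part A (Suc d) 0 w = (\<Sum>p\<le>d. bihom A (Suc p) (d - p) z w)"
    unfolding hom_part_eq_sum_bihom sum.atMost_Suc_shift using no_z [of "Suc d"] by (simp add: z)
qed

lemma hom_part_0_right:
  "hom_part A 0 z w = hom_part A 0 z 0"
  "hom_part A (Suc d) z w - hom_part A (Suc d) z 0 = (\<Sum>p\<le>d. bihom A p (Suc (d - p)) z w)"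
proof -
  have no_w: "bihom A p 0 z w = bihom A p 0 z 0" for p
    using wordfun_w_0 [OF wordfun_bihom] by metis
  have w: "bihom A p (Suc q) z 0 = 0" for p q
    using wordfun_scale [OF wordfun_bihom, of A p "Suc q" 1 z 0 0] by simp
  show "hom_part A 0 z w = hom_part A 0 z 0"
    by (simp add: hom_part_eq_sum_bihom no_w)
  show "hom_part A (Suc d) z w - hom_part A (Suc d) z 0 = (\<Sum>p\<le>d. bihom A p (Suc (d - p)) z w)"
    unfolding hom_part_eq_sum_bihom using no_w [of "Suc d"] by (simp add: w Suc_diff_le)
qed

definition div_part ::
    "(bool list \<Rightarrow> quat) \<Rightarrow> (bool list \<Rightarrow> quat) \<Rightarrow> nat \<Rightarrow> nat \<Rightarrow> quat \<Rightarrow> quat \<Rightarrow> quat \<Rightarrow> quat" where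
  "div_part A B p q h z w = dz h (bihom A (Suc p) q) z w + dw h (bihom B p (Suc q)) z w"

context
  fixes f g :: "quat \<Rightarrow> quat \<Rightarrow> quat" and D :: "quat \<Rightarrow> quat \<Rightarrow> quat"
    and A B :: "bool list \<Rightarrow> quat"
  assumes A: "entire_series A" and f: "\<And>z w. f z w = (\<Sum>d. hom_part A d z w)"
    and B: "entire_series B" and g: "\<And>z w. g z w = (\<Sum>d. hom_part B d z w)"
    and D: "has_divergence (\<lambda>z w. (f z w, g z w)) D"
begin

lemma div_part_sums: "(\<lambda>d. \<Sum>p\<le>d. div_part A B p (d - p) h z w) sums (h * D z w)"
proof -
  obtain l m where l: "has_partial_z f z w h l" and m: "has_partial_w g z w h m"
    and lm: "l + m = h * D z w"
    using D unfolding has_divergence_def by force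
  have "(\<lambda>d. dz h (hom_part A d) z w) sums l"
  proof (rule entire_series.hom_part_derivative_sums [OF A, of z h w 0])
    show "((\<lambda>t. (1 / t) *\<^sub>R ((\<Sum>d. hom_part A d (z + t *\<^sub>R h) (w + t *\<^sub>R 0))
        - (\<Sum>d. hom_part A d z w))) \<longlongrightarrow> l) (at 0)"
      using l by (simp only: has_partial_z_def f scaleR_zero_right add_0_right)
  qed (use has_dz in simp)
  then have "(\<lambda>d. dz h (hom_part A (Suc d)) z w) sums l"
    using sums_Suc_iff [of "\<lambda>d. dz h (hom_part A d) z w" l] by (simp add: dz_hom_part(1))
  moreover have "(\<lambda>d. dw h (hom_part B d) z w) sums m"
  proof (rule entire_series.hom_part_derivative_sums [OF B, of z 0 w h])
    show "((\<lambda>t. (1 / t) *\<^sub>R ((\<Sum>d. hom_part B d (z + t *\<^sub>R 0) (w + t *\<^sub>R h))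
        - (\<Sum>d. hom_part B d z w))) \<longlongrightarrow> m) (at 0)"
      using m by (simp only: has_partial_w_def g scaleR_zero_right add_0_right)
  qed (use has_dw in simp)
  then have "(\<lambda>d. dw h (hom_part B (Suc d)) z w) sums m"
    using sums_Suc_iff [of "\<lambda>d. dw h (hom_part B d) z w" m] by (simp add: dw_hom_part(1))
  ultimately have "(\<lambda>d. dz h (hom_part A (Suc d)) z w + dw h (hom_part B (Suc d)) z w) sums (l + m)"
    by (rule sums_add)
  then show ?thesis
    by (simp add: lm dz_hom_part(2) dw_hom_part(2) div_part_def sum.distrib)
qed

lemma div_part_scale:
  assumes "s \<noteq> 0" "t \<noteq> 0"
  shows "div_part A B p q h (s *\<^sub>R z) (t *\<^sub>R w) = (s ^ p * t ^ q) *\<^sub>R div_part A B p q h z w"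
proof -
  have "s *\<^sub>R dz h (bihom A (Suc p) q) (s *\<^sub>R z) (t *\<^sub>R w)
      = s *\<^sub>R (s ^ p * t ^ q) *\<^sub>R dz h (bihom A (Suc p) q) z w"
    using dz_scale [OF wordfun_bihom [of "Suc p" q A]] by simp
  moreover have "t *\<^sub>R dw h (bihom B p (Suc q)) (s *\<^sub>R z) (t *\<^sub>R w)
      = t *\<^sub>R (s ^ p * t ^ q) *\<^sub>R dw h (bihom B p (Suc q)) z w"
    using dw_scale [OF wordfun_bihom [of p "Suc q" B]] by (simp add: mult_ac)
  ultimately show ?thesis
    unfolding div_part_def scaleR_add_right
    using scaleR_left_imp_eq [OF assms(1)] scaleR_left_imp_eq [OF assms(2)] by metis
qed

text \<open>With \<open>z\<close> scaled by \<open>r s\<close> and \<open>w\<close> by \<open>r\<close>, the divergence condition for \<open>h\<close> minus \<open>h\<close> times the one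
for \<open>1\<close> is a power series in \<open>r\<close> whose coefficients are polynomials in \<open>s\<close>. It vanishes for all
nonzero \<open>r\<close> and \<open>s\<close>, hence so do all coefficients.\<close>

lemma div_part_eq: "div_part A B p q h z w = h * div_part A B p q 1 z w"
proof -
  define E where "E = (\<lambda>p q. div_part A B p q h z w - h * div_part A B p q 1 z w)"
  have "(\<Sum>i\<le>d. s ^ i *\<^sub>R E i (d - i)) = 0" if "s \<noteq> 0" for s d
  proof (rule power_series_zero [of "\<lambda>d. \<Sum>i\<le>d. s ^ i *\<^sub>R E i (d - i)"])
    fix r :: real assume "r \<noteq> 0"
    let ?z = "(r * s) *\<^sub>R z" and ?w = "r *\<^sub>R w"
    have "(\<lambda>d. (\<Sum>i\<le>d. div_part A B i (d - i) h ?z ?w) - h * (\<Sum>i\<le>d. div_part A B i (d - i) 1 ?z ?w))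
        sums (h * D ?z ?w - h * (1 * D ?z ?w))"
      by (intro sums_diff sums_mult div_part_sums)
    moreover have "(\<Sum>i\<le>d. div_part A B i (d - i) h ?z ?w) - h * (\<Sum>i\<le>d. div_part A B i (d - i) 1 ?z ?w)
        = r ^ d *\<^sub>R (\<Sum>i\<le>d. s ^ i *\<^sub>R E i (d - i))" for d
      unfolding sum_distrib_left scaleR_sum_right sum_subtractf [symmetric]
    proof (rule sum.cong)
      fix i assume "i \<in> {..d}"
      then have "(r * s) ^ i * r ^ (d - i) = r ^ d * s ^ i"
        by (simp add: power_mult_distrib flip: power_add)
      then show "div_part A B i (d - i) h ?z ?w - h * div_part A B i (d - i) 1 ?z ?w
          = r ^ d *\<^sub>R s ^ i *\<^sub>R E i (d - i)"
        using \<open>r \<noteq> 0\<close> \<open>s \<noteq> 0\<close> by (simp add: div_part_scale E_def scaleR_diff_right)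
    qed simp
    ultimately show "(\<lambda>d. r ^ d *\<^sub>R (\<Sum>i\<le>d. s ^ i *\<^sub>R E i (d - i))) sums 0" by simp
  qed
  then have "(\<Sum>i\<le>p + q. s ^ i *\<^sub>R E i (p + q - i)) = 0" if "s \<noteq> 0" for s
    using that by blast
  then have "(\<lambda>i. s ^ i *\<^sub>R (if i \<in> {..p + q} then E i (p + q - i) else 0)) sums 0" if "s \<noteq> 0" for s
    using sums_If_finite_set [of "{..p + q}" "\<lambda>i. s ^ i *\<^sub>R E i (p + q - i)"] that
    by (simp add: if_distrib [of "scaleR _"] cong: if_cong)
  from power_series_zero [OF this, of p] have "E p q = 0" by simp
  then show ?thesis by (simp add: E_def)
qed

lemma bihomogeneous_normal_form:
  obtains a b where
    "\<And>p q z w. bihom A (Suc p) q z w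
      = z * (S (int p) (int q) z w * a p q) + w * (S (int p + 1) (int q - 1) z w * b p q)"
    "\<And>p q z w. bihom B p (Suc q) z w
      = z * (- S (int p - 1) (int q + 1) z w * a p q) + w * (- S (int p) (int q) z w * b p q)"
    "\<And>p q z w. div_part A B p q 1 z w = S (int p) (int q) z w * (a p q - b p q)"
    "\<And>p q z w. bihom A (Suc p) q z w
      = z * S (int p) (int q) z w * (a p q - b p q) + S (int p + 1) (int q) z w * b p q"
proof -
  have "\<exists>a b. \<forall>z w. bihom A (Suc p) q z w
        = z * (S (int p) (int q) z w * a) + w * (S (int p + 1) (int q - 1) z w * b)
      \<and> bihom B p (Suc q) z w
        = z * (- S (int p - 1) (int q + 1) z w * a) + w * (- S (int p) (int q) z w * b)
      \<and> div_part A B p q 1 z w = S (int p) (int q) z w * (a - b)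
      \<and> bihom A (Suc p) q z w = z * S (int p) (int q) z w * (a - b) + S (int p + 1) (int q) z w * b"
    for p q
  proof -
    have "dz h (bihom A (Suc p) q) z w + dw h (bihom B p (Suc q)) z w = h * div_part A B p q 1 z w" for h z w
      using div_part_eq [of p q h z w] by (simp add: div_part_def [of A B p q h])
    from wordfun_with_divergence [OF wordfun_bihom wordfun_bihom this] show ?thesis by metis
  qed
  then show thesis using that by metis
qed

end

section \<open>The normal form\<close>

text \<open>At \<open>(1, 1)\<close> the functions \<open>S\<close> take positive integer values of at most \<open>2\<^bsup>p+q\<^esup>\<close>, so \<open>c\<close> and then
\<open>b\<close> can be estimated by the values of the two components at this single point.\<close>

lemma coefficient_bounds:
  fixes a b c F G :: quat
  assumes c: "S (int p) (int q) 1 1 * c = of_nat (Suc p) * F + of_nat (Suc q) * G"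
    and b: "F = S (int p) (int q) 1 1 * c + S (int p + 1) (int q) 1 1 * b"
    and a: "a = b + c"
  shows "norm a \<le> 3 * 4 ^ (p + q) * (norm F + norm G)" "norm b \<le> 3 * 4 ^ (p + q) * (norm F + norm G)"
proof -
  let ?n = "p + q" and ?N = "norm F + norm G"
  have S_ge: "norm (S (int p + 1) (int q) 1 1) \<ge> 1"
    using norm_S_1_1 [of "Suc p" q] by (simp add: add.commute)
  have S_le: "norm (S (int p) (int q) 1 1) \<le> 2 ^ ?n"
    using norm_S_le [of "int p" "int q" 1 1] by (simp flip: of_nat_add)
  have weight: "real (Suc ?n) \<le> 2 ^ ?n"
  proof -
    have "Suc ?n \<le> 2 ^ ?n" by (rule Suc_leI [OF less_exp])
    then show ?thesis by (metis of_nat_le_iff of_nat_numeral of_nat_power)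
  qed
  have "norm c \<le> norm (S (int p) (int q) 1 1) * norm c"
    using norm_S_1_1 [of p q] by (simp add: mult_le_cancel_right1)
  also have "\<dots> \<le> norm (of_nat (Suc p) * F) + norm (of_nat (Suc q) * G)"
    unfolding norm_mult [symmetric] c by (rule norm_triangle_ineq)
  also have "\<dots> = real (Suc p) * norm F + real (Suc q) * norm G"
    by (simp only: norm_mult norm_of_nat)
  also have "\<dots> \<le> 2 ^ ?n * norm F + 2 ^ ?n * norm G"
    using weight by (intro add_mono mult_right_mono) auto
  finally have c_le: "norm c \<le> 2 ^ ?n * ?N" by (simp add: distrib_left)
  have "norm b \<le> norm (S (int p + 1) (int q) 1 1) * norm b"
    using S_ge by (simp add: mult_le_cancel_right1)
  also have "\<dots> = norm (F - S (int p) (int q) 1 1 * c)"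
    unfolding norm_mult [symmetric] using b by (simp add: eq_diff_eq [symmetric])
  also have "\<dots> \<le> norm F + norm (S (int p) (int q) 1 1) * norm c"
    by (metis norm_mult norm_triangle_ineq4)
  also have "\<dots> \<le> ?N + 2 ^ ?n * (2 ^ ?n * ?N)"
    using S_le c_le by (intro add_mono mult_mono) auto
  also have "2 ^ ?n * (2 ^ ?n * ?N) = 4 ^ ?n * ?N"
    unfolding mult.assoc [symmetric] power_mult_distrib [symmetric] by simp
  finally have b_le: "norm b \<le> ?N + 4 ^ ?n * ?N" .
  have N: "?N \<ge> 0" "?N \<le> 4 ^ ?n * ?N"
    using mult_right_mono [of 1 "4 ^ ?n" ?N] by auto
  from b_le N show "norm b \<le> 3 * 4 ^ ?n * ?N" by linarith
  have "(2::real) ^ ?n \<le> 4 ^ ?n" by (intro power_mono) auto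
  with c_le have "norm c \<le> 4 ^ ?n * ?N"
    using mult_right_mono [of "2 ^ ?n" "4 ^ ?n" ?N] N(1) by linarith
  moreover have "norm a \<le> norm b + norm c" unfolding a by (rule norm_triangle_ineq)
  ultimately show "norm a \<le> 3 * 4 ^ ?n * ?N" using b_le N by linarith
qed

text \<open>The shifts \<open>i\<close> and \<open>j\<close> cover all the index patterns of the normal form, since each of them keeps
the total degree \<open>p + q\<close>.\<close>

lemma summable_on_S_coeff:
  fixes c :: "nat \<Rightarrow> nat \<Rightarrow> quat"
  assumes decay: "\<And>R. R > 0 \<Longrightarrow> \<exists>M. \<forall>p q. norm (c p q) * R ^ (p + q) \<le> M"
  shows "(\<lambda>(p, q). (S (int p + i) (int q - i) z w * c p q)) summable_on UNIV"
    "(\<lambda>(p, q). (S (int p + i) (int q - i) z w, - S (int p + j) (int q - j) z w) *\<^sub>r c p q) summable_on UNIV"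
proof -
  define K where "K = norm z + norm w + 1"
  have K: "K > 0" by (simp add: K_def add_nonneg_pos)
  obtain M where M: "\<And>p q. norm (c p q) * (2 * K) ^ (p + q) \<le> M"
    using decay [of "2 * K"] K by auto
  have bound: "norm (S (int p + i) (int q - i) z w * c p q) \<le> M * (1 / 2) ^ (p + q)" for p q i
  proof -
    have "norm (S (int p + i) (int q - i) z w) \<le> (norm z + norm w) ^ (p + q)"
      using norm_S_le [of "int p + i" "int q - i" z w] by (simp flip: of_nat_add)
    also have "\<dots> \<le> K ^ (p + q)"
      by (intro power_mono) (auto simp: K_def)
    finally have "norm (S (int p + i) (int q - i) z w * c p q) \<le> K ^ (p + q) * norm (c p q)"
      unfolding norm_mult by (rule mult_right_mono) simp
    also have "\<dots> \<le> K ^ (p + q) * (M / (2 * K) ^ (p + q))"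
      using M [of p q] K by (intro mult_left_mono) (auto simp: pos_le_divide_eq)
    also have "\<dots> = M * (1 / 2) ^ (p + q)"
      using K by (simp add: power_mult_distrib power_one_over field_simps)
    finally show ?thesis .
  qed
  show "(\<lambda>(p, q). (S (int p + i) (int q - i) z w * c p q)) summable_on UNIV"
    by (rule summable_on_half_powers [of _ M]) (simp add: bound)
  show "(\<lambda>(p, q). (S (int p + i) (int q - i) z w, - S (int p + j) (int q - j) z w) *\<^sub>r c p q) summable_on UNIV"
  proof (rule summable_on_half_powers [of _ "2 * M"])
    fix p q
    have "norm ((S (int p + i) (int q - i) z w, - S (int p + j) (int q - j) z w) *\<^sub>r c p q)
        \<le> norm (S (int p + i) (int q - i) z w * c p q) + norm (S (int p + j) (int q - j) z w * c p q)"
      using norm_Pair_le [of "S (int p + i) (int q - i) z w * c p q" "- S (int p + j) (int q - j) z w * c p q"]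
      by (simp add: rmult_def)
    also have "\<dots> \<le> 2 * M * (1 / 2) ^ (p + q)"
      using bound [of p i q] bound [of p j q] by simp
    finally show "norm ((\<lambda>(p, q). (S (int p + i) (int q - i) z w, - S (int p + j) (int q - j) z w) *\<^sub>r c p q) (p, q))
        \<le> 2 * M * (1 / 2) ^ (p + q)" by simp
  qed
qed

lemma has_sum_components:
  assumes "(\<lambda>(p, q). (x p q, y p q) *\<^sub>r c p q) summable_on UNIV"
  shows "((\<lambda>(p, q). x p q * c p q) has_sum fst (\<Sum>\<^sub>\<infinity>(p, q)\<in>UNIV. (x p q, y p q) *\<^sub>r c p q)) UNIV"
    "((\<lambda>(p, q). y p q * c p q) has_sum snd (\<Sum>\<^sub>\<infinity>(p, q)\<in>UNIV. (x p q, y p q) *\<^sub>r c p q)) UNIV"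
  using has_sum_bounded_linear [OF bounded_linear_fst has_sum_infsum [OF assms]]
    has_sum_bounded_linear [OF bounded_linear_snd has_sum_infsum [OF assms]]
  by (simp_all add: rmult_def case_prod_unfold)

theorem corollary3p5:
  fixes X :: "quat \<Rightarrow> quat \<Rightarrow> quat \<times> quat"
    and divX :: "quat \<Rightarrow> quat \<Rightarrow> quat"
  assumes "X \<in> VH1"
    and "has_divergence X divX"
  shows "\<exists>(a :: nat \<Rightarrow> nat \<Rightarrow> quat) (b :: nat \<Rightarrow> nat \<Rightarrow> quat) (g0 :: quat \<Rightarrow> quat) (f0 :: quat \<Rightarrow> quat).
    \<forall>z w.
      (\<lambda>(p, q). (S (int p) (int q) z w, - S (int p - 1) (int q + 1) z w) *\<^sub>r a p q) summable_on UNIV \<and>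
      (\<lambda>(p, q). (S (int p + 1) (int q - 1) z w, - S (int p) (int q) z w) *\<^sub>r b p q) summable_on UNIV \<and>
      X z w =
        z *\<^sub>l (\<Sum>\<^sub>\<infinity>(p, q)\<in>UNIV. (S (int p) (int q) z w, - S (int p - 1) (int q + 1) z w) *\<^sub>r a p q)
        + w *\<^sub>l (\<Sum>\<^sub>\<infinity>(p, q)\<in>UNIV. (S (int p + 1) (int q - 1) z w, - S (int p) (int q) z w) *\<^sub>r b p q)
        + (g0 w, f0 z) \<and>
      ((\<lambda>(p, q). S (int p) (int q) z w * (a p q - b p q)) has_sum divX z w) UNIV"
proof -
  \<comment> \<open>The witnesses for \<open>g\<^sub>0\<close> and \<open>f\<^sub>0\<close> are \<open>f 0\<close> and \<open>\<lambda>z. g z 0\<close>: setting \<open>z = 0\<close> in \<open>f\<close> leaves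
    exactly the words without \<open>z\<close>, and symmetrically for \<open>g\<close>.\<close>
  define f where "f = (\<lambda>z w. fst (X z w))"
  define g where "g = (\<lambda>z w. snd (X z w))"
  from assms(1) have "f \<in> H1" "g \<in> H1" by (auto simp: VH1_def f_def g_def)
  then obtain A B where
    A: "entire_series A" and f: "\<And>z w. f z w = (\<Sum>d. hom_part A d z w)" and
    B: "entire_series B" and g: "\<And>z w. g z w = (\<Sum>d. hom_part B d z w)"
    unfolding H1_def entire_series_def by blast
  have X: "X = (\<lambda>z w. (f z w, g z w))" by (simp add: f_def g_def)
  note field = A f B g assms(2) [unfolded X]
  obtain a b where
    f_part: "\<And>p q z w. bihom A (Suc p) q z w
      = z * (S (int p) (int q) z w * a p q) + w * (S (int p + 1) (int q - 1) z w * b p q)" and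
    g_part: "\<And>p q z w. bihom B p (Suc q) z w
      = z * (- S (int p - 1) (int q + 1) z w * a p q) + w * (- S (int p) (int q) z w * b p q)" and
    div_part: "\<And>p q z w. div_part A B p q 1 z w = S (int p) (int q) z w * (a p q - b p q)" and
    f_part': "\<And>p q z w. bihom A (Suc p) q z w
      = z * S (int p) (int q) z w * (a p q - b p q) + S (int p + 1) (int q) z w * b p q"
    using bihomogeneous_normal_form [OF field] by blast
  have coefficients: "norm (a p q) \<le> 3 * 4 ^ (p + q) * (norm (bihom A (Suc p) q 1 1) + norm (bihom B p (Suc q) 1 1))"
    "norm (b p q) \<le> 3 * 4 ^ (p + q) * (norm (bihom A (Suc p) q 1 1) + norm (bihom B p (Suc q) 1 1))" for p q
  proof -
    have "S (int p) (int q) 1 1 * (a p q - b p q)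
        = of_nat (Suc p) * bihom A (Suc p) q 1 1 + of_nat (Suc q) * bihom B p (Suc q) 1 1"
      unfolding div_part [symmetric] div_part_def
      using euler_z [OF wordfun_bihom [of "Suc p" q A], of 1 1] euler_w [OF wordfun_bihom [of p "Suc q" B], of 1 1]
      by simp
    from coefficient_bounds [OF this, of "b p q" "a p q"] f_part' [of p q 1 1]
    show "norm (a p q) \<le> 3 * 4 ^ (p + q) * (norm (bihom A (Suc p) q 1 1) + norm (bihom B p (Suc q) 1 1))"
      "norm (b p q) \<le> 3 * 4 ^ (p + q) * (norm (bihom A (Suc p) q 1 1) + norm (bihom B p (Suc q) 1 1))"
      by simp_all
  qed
  have decay: "\<exists>M. \<forall>p q. norm (c p q) * R ^ (p + q) \<le> M"
    if "R > 0" and c: "\<And>p q. norm (c p q)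
      \<le> 3 * 4 ^ (p + q) * (norm (bihom A (Suc p) q 1 1) + norm (bihom B p (Suc q) 1 1))"
    for R and c :: "nat \<Rightarrow> nat \<Rightarrow> quat"
  proof -
    from \<open>R > 0\<close> have "4 * R > 0" by simp
    obtain M N where M: "\<And>p q. norm (bihom A p q 1 1) * (4 * R) ^ (p + q) \<le> M"
      and N: "\<And>p q. norm (bihom B p q 1 1) * (4 * R) ^ (p + q) \<le> N"
      using entire_series.bihom_bound [OF A \<open>4 * R > 0\<close>] entire_series.bihom_bound [OF B \<open>4 * R > 0\<close>] by metis
    have "norm (c p q) * R ^ (p + q) \<le> 3 * (M + N) / (4 * R)" for p q
    proof -
      let ?F = "norm (bihom A (Suc p) q 1 1)" and ?G = "norm (bihom B p (Suc q) 1 1)"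
      have "norm (c p q) * R ^ (p + q) \<le> 3 * 4 ^ (p + q) * (?F + ?G) * R ^ (p + q)"
        using c \<open>R > 0\<close> by (intro mult_right_mono) auto
      also have "\<dots> = 3 * ((?F + ?G) * (4 * R) ^ (p + q))"
        by (simp add: power_mult_distrib)
      also have "(?F + ?G) * (4 * R) ^ (p + q) \<le> (M + N) / (4 * R)"
        using M [of "Suc p" q] N [of p "Suc q"] \<open>R > 0\<close>
        by (simp add: pos_le_divide_eq algebra_simps)
      finally show ?thesis by simp
    qed
    then show ?thesis by blast
  qed
  have a_decay: "\<exists>M. \<forall>p q. norm (a p q) * R ^ (p + q) \<le> M"
    and b_decay: "\<exists>M. \<forall>p q. norm (b p q) * R ^ (p + q) \<le> M" if "R > 0" for R
    using decay [OF that coefficients(1)] decay [OF that coefficients(2)] by auto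
  show ?thesis
  proof (intro exI allI conjI)
    fix z w
    show a_sum: "(\<lambda>(p, q). (S (int p) (int q) z w, - S (int p - 1) (int q + 1) z w) *\<^sub>r a p q) summable_on UNIV"
      using summable_on_S_coeff(2) [OF a_decay, of 0 z w "-1"] by simp
    show b_sum: "(\<lambda>(p, q). (S (int p + 1) (int q - 1) z w, - S (int p) (int q) z w) *\<^sub>r b p q) summable_on UNIV"
      using summable_on_S_coeff(2) [OF b_decay, of 1 z w 0] by simp
    let ?a = "\<Sum>\<^sub>\<infinity>(p, q)\<in>UNIV. (S (int p) (int q) z w, - S (int p - 1) (int q + 1) z w) *\<^sub>r a p q"
    let ?b = "\<Sum>\<^sub>\<infinity>(p, q)\<in>UNIV. (S (int p + 1) (int q - 1) z w, - S (int p) (int q) z w) *\<^sub>r b p q"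
    have conv: "summable (\<lambda>d. hom_part A d z w)" "summable (\<lambda>d. hom_part B d z w)" for z w
      using A B by (auto simp: entire_series_def intro: summable_norm_cancel)
    have "((\<lambda>(p, q). bihom A (Suc p) q z w) has_sum (z * fst ?a + w * fst ?b)) UNIV"
      unfolding f_part using has_sum_add [OF
          has_sum_cmult_right [OF has_sum_components(1) [OF a_sum], of z]
          has_sum_cmult_right [OF has_sum_components(1) [OF b_sum], of w]]
      by (simp add: case_prod_unfold)
    from has_sum_diagonals [OF this]
    have "(\<lambda>d. hom_part A (Suc d) z w - hom_part A (Suc d) 0 w) sums (z * fst ?a + w * fst ?b)"
      by (simp add: hom_part_0_left)
    then have "(\<lambda>d. hom_part A d z w - hom_part A d 0 w) sums (z * fst ?a + w * fst ?b)"
      using sums_Suc_iff [of "\<lambda>d. hom_part A d z w - hom_part A d 0 w"] hom_part_0_left(1) [of A z w] by simp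
    moreover have "(\<lambda>d. hom_part A d z w - hom_part A d 0 w) sums (f z w - f 0 w)"
      unfolding f by (intro sums_diff summable_sums conv)
    ultimately have f_eq: "f z w - f 0 w = z * fst ?a + w * fst ?b"
      by (rule sums_unique2 [symmetric])
    have "((\<lambda>(p, q). bihom B p (Suc q) z w) has_sum (z * snd ?a + w * snd ?b)) UNIV"
      unfolding g_part using has_sum_add [OF
          has_sum_cmult_right [OF has_sum_components(2) [OF a_sum], of z]
          has_sum_cmult_right [OF has_sum_components(2) [OF b_sum], of w]]
      by (simp add: case_prod_unfold)
    from has_sum_diagonals [OF this]
    have "(\<lambda>d. hom_part B (Suc d) z w - hom_part B (Suc d) z 0) sums (z * snd ?a + w * snd ?b)"
      by (simp add: hom_part_0_right)
    then have "(\<lambda>d. hom_part B d z w - hom_part B d z 0) sums (z * snd ?a + w * snd ?b)"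
      using sums_Suc_iff [of "\<lambda>d. hom_part B d z w - hom_part B d z 0"] hom_part_0_right(1) [of B z w] by simp
    moreover have "(\<lambda>d. hom_part B d z w - hom_part B d z 0) sums (g z w - g z 0)"
      unfolding g by (intro sums_diff summable_sums conv)
    ultimately have g_eq: "g z w - g z 0 = z * snd ?a + w * snd ?b"
      by (rule sums_unique2 [symmetric])
    show "X z w = z *\<^sub>l ?a + w *\<^sub>l ?b + (f 0 w, g z 0)"
      using f_eq g_eq by (simp add: X lmult_def diff_eq_eq)
    have "(\<lambda>(p, q). S (int p) (int q) z w * (a p q - b p q)) summable_on UNIV"
      using summable_on_add [OF summable_on_S_coeff(1) [OF a_decay, of 0 z w]
          summable_on_uminus [THEN iffD2, OF summable_on_S_coeff(1) [OF b_decay, of 0 z w]]]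
      by (simp add: case_prod_unfold right_diff_distrib)
    then obtain x where x: "((\<lambda>(p, q). S (int p) (int q) z w * (a p q - b p q)) has_sum x) UNIV"
      unfolding summable_on_def by blast
    then have "(\<lambda>d. \<Sum>p\<le>d. div_part A B p (d - p) 1 z w) sums x"
      using has_sum_diagonals [OF x] by (simp add: div_part)
    then have "x = divX z w"
      using div_part_sums [OF field, of 1 z w] sums_unique2 by fastforce
    with x show "((\<lambda>(p, q). S (int p) (int q) z w * (a p q - b p q)) has_sum divX z w) UNIV" by simp
  qed
qed

end
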